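(* Let $p,q\in(1,\infty)$, and let $\alpha,\beta\in[0,1)$ satisfy $\alpha<1-\frac1p$, $\beta<1-\frac1q$ and assume that $$\tilde\sigma:=1-\frac d2\Bigl(\frac1p+\frac1q\Bigr)-\frac{\alpha+\beta}2>0 .$$ Fix $\varepsilon\in(0,1-\tilde\sigma)$. Then there exist $s,t\in(0,1]$ such that $s+t=1-\frac\varepsilon2$ and $$\sigma_1:=s-\tfrac\alpha2-\tfrac d{2p}>0,\qquad \sigma_2:=t-\tfrac\beta2-\tfrac d{2q}>0 .$$ If $\mathbf a\in L^1(\square_0)\cap W^{-\alpha,p}(\square_0)$ and $\mathbf a^{-1}\in L^1(\square_0)\cap W^{-\beta,q}(\square_0)$, then $\mathbf a$ is coarse-grained elliptic in $\square_0$ with parameters $(s,t)$ (in particular $\Theta_{s,t}(\square_0;\mathcal K_{\mathrm{pow}}\cup\mathcal K_{\mathrm{trunc}})\le\Theta_{s,t}(\square_0;\mathcal K_{\max})<\infty$), and $$\Theta_{s,t}(\square_0;\mathcal K_{\max})\le\frac{\mathfrak c_s^2\,\mathfrak c_t^2}{\mathfrak c_{\sigma_1}^2\,\mathfrak c_{\sigma_2}^2}\Bigl(\frac{C}{\alpha p'(1-\alpha p')}\Bigr)^{\frac1{p'}}\Bigl(\frac{C}{\beta q'(1-\beta q')}\Bigr)^{\frac1{q'}}\|\mathbf a\|_{W^{-\alpha,p}(\square_0)}\|\mathbf a^{-1}\|_{W^{-\beta,q}(\square_0)},$$ where $C=C(d)<\infty$, $p'=\frac p{p-1}$, $q'=\frac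 q{q-1}$.
   Context: Notation: the dimension is $d\ge2$; $\square_m=(-\frac12 3^m,\frac12 3^m)^d$; $\fint_U$ is the average over $U$; $\mathfrak c_s=1-3^{-s}$. Sobolev spaces: for $\alpha\in(0,1)$, $r\in(1,\infty)$, $W^{\alpha,r}(\square_0)$ has norm $\bigl(\|f\|_{L^r(\square_0)}^r+\int_{\square_0}\int_{\square_0}\frac{|f(x)-f(y)|^r}{|x-y|^{d+\alpha r}}dx\,dy\bigr)^{1/r}$, and $W^{-\alpha,p}(\square_0)$ is the dual of $W^{\alpha,p'}(\square_0)$ (with $W^{0,p}=L^p$). A matrix field belongs to such a space if each of its entries does. Coefficient field: $\mathbf a$ is a measurable map from a bounded Lipschitz domain $U\subseteq\mathbb R^d$ (here $U=\square_0$) to symmetric positive semi-definite $d\times d$ matrices, invertible a.e., with $\mathbf a,\mathbf a^{-1}\in L^1(U)$. $H^1_{\mathbf a}(U)$ is the completion of $C^\infty(U)$ with respect to the norm $(\|u\|_{L^2(U)}^2+\int_U\nabla u\cdot\mathbf a\nabla u)^{1/2}$. $\mathcal A(U)$ is the set of $u\in H^1_{\mathbf a}(U)$ with $\int_U\nabla\psi\cdot\mathbf a\nabla u=0$ for all $\psi\in C_c^\infty(U)$. Cones: $\mathcal K_{\max}(U)=H^1_{\mathbf a}(U)$; $\mathcal K_{\mathrm{trunc}}(U)=\{(u-k)_+: u\in\mathcal A(U),\,k\in\mathbb R\}$; $\mathcal K_{\mathrm{pow}}(U)$ is the set of $\Phi(u)\in H^1_{\mathbf a}(U)$ with $u\in\mathcal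 A(U)$, $u\ge0$, $\Phi:u(U)\to\mathbb R$ convex and monotone with $\Phi'(u)=Ku^{r}$ for some $K,r\in\mathbb R$. Coarse-grained quantities: for a cone family $\mathcal K$ and $e\in\mathbb R^d$, $\mathbf a(U,e;\mathcal K)=\sup_{u\in\mathcal K(U)}\fint_U(-\nabla u\cdot\mathbf a\nabla u+2e\cdot\mathbf a\nabla u)$ and $\|\mathbf a(U;\mathcal K)\|=\sup_{|e|=1}\mathbf a(U,e;\mathcal K)$; the symmetric positive matrix $\mathbf a_*^{-1}(U)$ is defined by $e\cdot\mathbf a_*^{-1}(U)e=\sup_{u\in\mathcal A(U)}\fint_U(-\nabla u\cdot\mathbf a\nabla u+2e\cdot\nabla u)$; $|\cdot|$ is the spectral norm. Set $$\Lambda_s(\square_m;\mathcal K)=\Bigl(\mathfrak c_s\sum_{k=-\infty}^m3^{-s(m-k)}\max_{z\in3^k\mathbb Z^d\cap\square_m}\|\mathbf a(z+\square_k;\mathcal K)\|^{1/2}\Bigr)^2,$$ $$\lambda_s(\square_m)=\Bigl(\mathfrak c_s\sum_{k=-\infty}^m3^{-s(m-k)}\max_{z\in3^k\mathbb Z^d\cap\square_m}|\mathbf a_*^{-1}(z+\square_k)|^{1/2}\Bigr)^{-2},$$ and $\Theta_{s,t}(\square_m;\mathcal K)=\Lambda_s(\square_m;\mathcal K)/\lambda_t(\square_m)$. The field $\mathbf a$ is coarse-grained elliptic in $\square_m$ if there exist $s,t\in(0,1)$ such that $s+t<1$ and $\Theta_{s,t}(\square_m;\mathcal K_{\mathrm{pow}}\cup\mathcal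 K_{\mathrm{trunc}})<\infty$; "with parameters $(s,t)$" means that this holds for the given $s,t$.
   Formalization: The existence of s,t is claimed only when also ε<2σ̃, which is necessary since σ_1+σ_2=σ̃−ε/2 (it fails e.g. for d=2, α=β=0, p=q=2.2, ε=1/2); the ellipticity and the estimate are proved for all s,t with the stated properties. *)

theory Defs
  imports "HOL-Analysis.Analysis"
begin

section \<open>Averages, cubes and powers in the extended half-line\<close>

definition average :: "(real^'n) set \<Rightarrow> (real^'n \<Rightarrow> real) \<Rightarrow> real"
  where "average U f = (\<integral>x. f x \<partial>lebesgue_on U) / measure lebesgue U"

definition cube :: "int \<Rightarrow> (real^'n) set"
  where "cube m = {x. \<forall>i. \<bar>x $ i\<bar> < 3 powi m / 2}"

definition triadic_lattice :: "int \<Rightarrow> (real^'n) set"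
  where "triadic_lattice k = {z. \<forall>i. \<exists>j::int. z $ i = 3 powi k * of_int j}"

definition scale_const :: "real \<Rightarrow> real"
  where "scale_const s = 1 - 3 powr (- s)"

text \<open>The power of an extended nonnegative real, intended for exponents \<open>r > 0\<close>.\<close>

definition ennpow :: "ennreal \<Rightarrow> real \<Rightarrow> ennreal"
  where "ennpow x r = (if x = top then top else ennreal (enn2real x powr r))"


section \<open>Fractional Sobolev spaces and their duals\<close>

text \<open>For \<open>\<alpha> = 0\<close> the space is \<open>L\<^sup>r\<close>.  Elements are functions rather than classes; the
  norm does not distinguish functions that agree almost everywhere.\<close>

definition sobolev_norm :: "(real^'n) set \<Rightarrow> real \<Rightarrow> real \<Rightarrow> (real^'n \<Rightarrow> real) \<Rightarrow> ennreal"
  where "sobolev_norm U \<alpha> r f =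
    ennpow ((\<integral>\<^sup>+x. ennreal (\<bar>f x\<bar> powr r) \<partial>lebesgue_on U) +
            (if \<alpha> = 0 then 0
             else \<integral>\<^sup>+x. (\<integral>\<^sup>+y. ennreal (\<bar>f x - f y\<bar> powr r / norm (x - y) powr (real CARD('n) + \<alpha> * r))
                    \<partial>lebesgue_on U) \<partial>lebesgue_on U)) (1 / r)"

definition sobolev_space :: "(real^'n) set \<Rightarrow> real \<Rightarrow> real \<Rightarrow> (real^'n \<Rightarrow> real) set"
  where "sobolev_space U \<alpha> r = {f \<in> borel_measurable (lebesgue_on U). sobolev_norm U \<alpha> r f < top}"

text \<open>Bounded linear functionals on \<open>W\<^bsup>\<alpha>,r\<^esup>(U)\<close>; their values outside that space are irrelevant.\<close>

definition sobolev_dual :: "(real^'n) set \<Rightarrow> real \<Rightarrow> real \<Rightarrow> ((real^'n \<Rightarrow> real) \<Rightarrow> real) set"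
  where "sobolev_dual U \<alpha> r = {L.
    (\<forall>f\<in>sobolev_space U \<alpha> r. \<forall>g\<in>sobolev_space U \<alpha> r. L (\<lambda>x. f x + g x) = L f + L g) \<and>
    (\<forall>f\<in>sobolev_space U \<alpha> r. \<forall>c. L (\<lambda>x. c * f x) = c * L f) \<and>
    (\<exists>B. \<forall>f\<in>sobolev_space U \<alpha> r. \<bar>L f\<bar> \<le> B * enn2real (sobolev_norm U \<alpha> r f))}"

definition sobolev_dual_norm ::
    "(real^'n) set \<Rightarrow> real \<Rightarrow> real \<Rightarrow> ((real^'n \<Rightarrow> real) \<Rightarrow> real) \<Rightarrow> real"
  where "sobolev_dual_norm U \<alpha> r L =
    (SUP f\<in>{f \<in> sobolev_space U \<alpha> r. sobolev_norm U \<alpha> r f \<le> 1}. \<bar>L f\<bar>)"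

text \<open>An integrable function \<open>f\<close> is identified with the functional \<open>g \<mapsto> \<integral>f g\<close>, which is
  defined for bounded \<open>g\<close>.  Bounded functions are dense in \<open>W\<^bsup>\<alpha>,r\<^esup>(U)\<close> by truncation, so
  the functional is determined on \<open>W\<^bsup>\<alpha>,r\<^esup>(U)\<close>.\<close>

definition represents ::
    "(real^'n) set \<Rightarrow> real \<Rightarrow> real \<Rightarrow> (real^'n \<Rightarrow> real) \<Rightarrow> ((real^'n \<Rightarrow> real) \<Rightarrow> real) \<Rightarrow> bool"
  where "represents U \<alpha> r f L \<longleftrightarrow> L \<in> sobolev_dual U \<alpha> r \<and>
    (\<forall>g\<in>sobolev_space U \<alpha> r. bounded (g ` U) \<longrightarrow> L g = (\<integral>x. f x * g x \<partial>lebesgue_on U))"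

definition in_neg_sobolev :: "(real^'n) set \<Rightarrow> real \<Rightarrow> real \<Rightarrow> (real^'n \<Rightarrow> real) \<Rightarrow> bool"
  where "in_neg_sobolev U \<alpha> p f \<longleftrightarrow> integrable (lebesgue_on U) f \<and>
    (\<exists>L. represents U \<alpha> (p / (p - 1)) f L)"

definition neg_sobolev_norm :: "(real^'n) set \<Rightarrow> real \<Rightarrow> real \<Rightarrow> (real^'n \<Rightarrow> real) \<Rightarrow> real"
  where "neg_sobolev_norm U \<alpha> p f =
    sobolev_dual_norm U \<alpha> (p / (p - 1)) (SOME L. represents U \<alpha> (p / (p - 1)) f L)"

definition in_neg_sobolev_mat ::
    "(real^'n) set \<Rightarrow> real \<Rightarrow> real \<Rightarrow> (real^'n \<Rightarrow> real^'n^'n) \<Rightarrow> bool"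
  where "in_neg_sobolev_mat U \<alpha> p b \<longleftrightarrow> (\<forall>i j. in_neg_sobolev U \<alpha> p (\<lambda>x. b x $ i $ j))"

text \<open>The Euclidean combination of the norms of the entries.\<close>

definition neg_sobolev_norm_mat ::
    "(real^'n) set \<Rightarrow> real \<Rightarrow> real \<Rightarrow> (real^'n \<Rightarrow> real^'n^'n) \<Rightarrow> real"
  where "neg_sobolev_norm_mat U \<alpha> p b =
    sqrt (\<Sum>i\<in>UNIV. \<Sum>j\<in>UNIV. (neg_sobolev_norm U \<alpha> p (\<lambda>x. b x $ i $ j))\<^sup>2)"


section \<open>Coefficient fields, the weighted Sobolev space and solutions\<close>

definition coefficient_field :: "(real^'n) set \<Rightarrow> (real^'n \<Rightarrow> real^'n^'n) \<Rightarrow> bool"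
  where "coefficient_field U a \<longleftrightarrow>
    (\<forall>x\<in>U. transpose (a x) = a x \<and> (\<forall>\<xi>. 0 \<le> \<xi> \<bullet> (a x *v \<xi>))) \<and>
    (AE x in lebesgue_on U. invertible (a x)) \<and>
    integrable (lebesgue_on U) a \<and>
    integrable (lebesgue_on U) (\<lambda>x. matrix_inv (a x))"

definition grad :: "(real^'n \<Rightarrow> real) \<Rightarrow> real^'n \<Rightarrow> real^'n"
  where "grad f x = (\<chi> i. frechet_derivative f (at x) (axis i 1))"

text \<open>\<open>k\<close> times continuously differentiable on an open set.\<close>

fun Ck_on :: "nat \<Rightarrow> (real^'n) set \<Rightarrow> (real^'n \<Rightarrow> real) \<Rightarrow> bool"
  where
    "Ck_on 0 U f \<longleftrightarrow> continuous_on U f"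
  | "Ck_on (Suc k) U f \<longleftrightarrow>
      (\<forall>x\<in>U. f differentiable (at x)) \<and> (\<forall>i. Ck_on k U (\<lambda>x. grad f x $ i))"

definition smooth_on :: "(real^'n) set \<Rightarrow> (real^'n \<Rightarrow> real) \<Rightarrow> bool"
  where "smooth_on U f \<longleftrightarrow> (\<forall>k. Ck_on k U f)"

definition test_functions :: "(real^'n) set \<Rightarrow> (real^'n \<Rightarrow> real) set"
  where "test_functions U =
    {\<psi>. smooth_on UNIV \<psi> \<and> compact (closure {x. \<psi> x \<noteq> 0}) \<and> closure {x. \<psi> x \<noteq> 0} \<subseteq> U}"

text \<open>The square of the norm of \<open>H\<^sup>1\<^sub>a(U)\<close>, as a function of a pair (function, gradient).\<close>

definition H1_norm_sq ::
    "(real^'n) set \<Rightarrow> (real^'n \<Rightarrow> real^'n^'n) \<Rightarrow> (real^'n \<Rightarrow> real) \<Rightarrow> (real^'n \<Rightarrow> real^'n) \<Rightarrow> ennreal"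
  where "H1_norm_sq U a u v =
    (\<integral>\<^sup>+x. ennreal ((u x)\<^sup>2) \<partial>lebesgue_on U) + (\<integral>\<^sup>+x. ennreal (v x \<bullet> (a x *v v x)) \<partial>lebesgue_on U)"

text \<open>The norm embeds the smooth functions isometrically, by \<open>\<phi> \<mapsto> (\<phi>, \<nabla>\<phi>)\<close>, into the
  complete space of pairs with finite norm, so that the completion is the closure of
  the image.  Its elements are the pairs \<open>(u, v)\<close> below, with \<open>v\<close> playing the role of
  \<open>\<nabla>u\<close>.  If \<open>a\<^sup>-\<^sup>1\<close> is integrable, then \<open>v\<close> is the weak gradient of \<open>u\<close>; in
  particular \<open>u\<close> determines \<open>v\<close> almost everywhere.\<close>

definition H1 ::
    "(real^'n) set \<Rightarrow> (real^'n \<Rightarrow> real^'n^'n) \<Rightarrow> ((real^'n \<Rightarrow> real) \<times> (real^'n \<Rightarrow> real^'n)) set"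
  where "H1 U a = {(u, v).
    u \<in> borel_measurable (lebesgue_on U) \<and> v \<in> borel_measurable (lebesgue_on U) \<and>
    (\<exists>\<phi>::nat \<Rightarrow> real^'n \<Rightarrow> real.
       (\<forall>n. smooth_on U (\<phi> n) \<and> H1_norm_sq U a (\<phi> n) (grad (\<phi> n)) < top) \<and>
       (\<lambda>n. H1_norm_sq U a (\<lambda>x. \<phi> n x - u x) (\<lambda>x. grad (\<phi> n) x - v x)) \<longlonglongrightarrow> 0)}"

definition solutions :: "(real^'n) set \<Rightarrow> (real^'n \<Rightarrow> real^'n^'n) \<Rightarrow> (real^'n \<Rightarrow> real) set"
  where "solutions U a = {u. \<exists>v. (u, v) \<in> H1 U a \<and>
    (\<forall>\<psi>\<in>test_functions U. (\<integral>x. grad \<psi> x \<bullet> (a x *v v x) \<partial>lebesgue_on U) = 0)}"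


section \<open>Cones\<close>

type_synonym 'n cone = "(real^'n) set \<Rightarrow> (real^'n \<Rightarrow> real^'n^'n) \<Rightarrow> (real^'n \<Rightarrow> real) set"

definition K_max :: "('n::finite) cone"
  where "K_max U a = {u. \<exists>v. (u, v) \<in> H1 U a}"

definition K_trunc :: "('n::finite) cone"
  where "K_trunc U a = {\<lambda>x. max (u x - k) 0 | u k. u \<in> solutions U a}"

text \<open>The domain of \<open>\<Phi>\<close> is the interval spanned by the range of \<open>u\<close>.  The conventions for
  \<open>\<Phi>' = K y\<^sup>r\<close> at \<open>y = 0\<close> are \<open>0\<^sup>0 = 1\<close>, \<open>0\<^sup>r = 0\<close> for \<open>r > 0\<close>, and that \<open>0\<close> is not in the
  range if \<open>r < 0\<close>.  Monotone means nondecreasing or nonincreasing.\<close>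

definition K_pow :: "('n::finite) cone"
  where "K_pow U a = {w \<in> K_max U a. \<exists>u \<Phi> K r.
    u \<in> solutions U a \<and> (\<forall>x\<in>U. 0 \<le> u x) \<and> w = (\<lambda>x. \<Phi> (u x)) \<and>
    (let I = convex hull (u ` U) in
       convex_on I \<Phi> \<and> (mono_on I \<Phi> \<or> antimono_on I \<Phi>) \<and> (r < 0 \<longrightarrow> 0 \<notin> I) \<and>
       (\<forall>y\<in>I. (\<Phi> has_real_derivative K * (if r = 0 then 1 else y powr r)) (at y within I)))}"

definition K_union :: "('n::finite) cone \<Rightarrow> ('n::finite) cone \<Rightarrow> ('n::finite) cone"
  where "K_union K L U a = K U a \<union> L U a"


section \<open>Coarse-grained quantities\<close>

definition cg_coeff ::
    "('n::finite) cone \<Rightarrow> (real^'n \<Rightarrow> real^'n^'n) \<Rightarrow> (real^'n) set \<Rightarrow> real^'n \<Rightarrow> ereal"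
  where "cg_coeff K a U e =
    (SUP (u, v) \<in> {(u, v). u \<in> K U a \<and> (u, v) \<in> H1 U a}.
      ereal (average U (\<lambda>x. - (v x \<bullet> (a x *v v x)) + 2 * (e \<bullet> (a x *v v x)))))"

definition cg_norm :: "('n::finite) cone \<Rightarrow> (real^'n \<Rightarrow> real^'n^'n) \<Rightarrow> (real^'n) set \<Rightarrow> ereal"
  where "cg_norm K a U = (SUP e \<in> {e. norm e = 1}. cg_coeff K a U e)"

definition astar_inv :: "(real^'n \<Rightarrow> real^'n^'n) \<Rightarrow> (real^'n) set \<Rightarrow> real^'n^'n"
  where "astar_inv a U = (THE M. transpose M = M \<and>
    (\<forall>e. ereal (e \<bullet> (M *v e)) =
      (SUP (u, v) \<in> {(u, v). u \<in> solutions U a \<and> (u, v) \<in> H1 U a}.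
        ereal (average U (\<lambda>x. - (v x \<bullet> (a x *v v x)) + 2 * (e \<bullet> v x))))))"

text \<open>Below, the scales \<open>k = m, m - 1, \<dots>\<close> are enumerated as \<open>k = m - j\<close> with \<open>j\<close> natural, and the
  supremum over the finite set of cubes of a given scale is a maximum.  The conversion
  to \<open>ennreal\<close> loses nothing for cones that contain a function with zero gradient, such
  as all the cones above, since the supremum is then nonnegative.\<close>

definition Lambda_cg :: "real \<Rightarrow> int \<Rightarrow> ('n::finite) cone \<Rightarrow> (real^'n \<Rightarrow> real^'n^'n) \<Rightarrow> ennreal"
  where "Lambda_cg s m K a =
    (ennreal (scale_const s) *
      (\<Sum>j. ennreal (3 powr (- s * real j)) *
         (SUP z \<in> triadic_lattice (m - int j) \<inter> cube m.
            ennpow (e2ennreal (cg_norm K a ((+) z ` cube (m - int j)))) (1/2))))\<^sup>2"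

definition lambda_cg :: "real \<Rightarrow> int \<Rightarrow> (real^'n \<Rightarrow> real^'n^'n) \<Rightarrow> ennreal"
  where "lambda_cg s m a = inverse
    ((ennreal (scale_const s) *
      (\<Sum>j. ennreal (3 powr (- s * real j)) *
         (SUP z \<in> triadic_lattice (m - int j) \<inter> cube m.
            ennreal (sqrt (onorm ((*v) (astar_inv a ((+) z ` cube (m - int j)))))))))\<^sup>2)"

definition Theta_cg :: "real \<Rightarrow> real \<Rightarrow> int \<Rightarrow> ('n::finite) cone \<Rightarrow> (real^'n \<Rightarrow> real^'n^'n) \<Rightarrow> ennreal"
  where "Theta_cg s t m K a = Lambda_cg s m K a / lambda_cg t m a"

definition cg_elliptic_with :: "int \<Rightarrow> (real^'n \<Rightarrow> real^'n^'n) \<Rightarrow> real \<Rightarrow> real \<Rightarrow> bool"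
  where "cg_elliptic_with m a s t \<longleftrightarrow>
    0 < s \<and> s < 1 \<and> 0 < t \<and> t < 1 \<and> s + t < 1 \<and> Theta_cg s t m (K_union K_pow K_trunc) a < top"

end

theory Submission
  imports Defs
begin

text \<open>
  Completing the square pointwise bounds \<open>a(U, e; K)\<close> by the average of \<open>e \<cdot> a e\<close> over \<open>U\<close>, for
  every cone, and \<open>e \<cdot> a\<^sub>*\<^sup>-\<^sup>1(U) e\<close> by the average of \<open>e \<cdot> a\<^sup>-\<^sup>1 e\<close>.  The average of an entry over a cube
  of side \<open>\<ell>\<close> is \<open>\<ell>\<^sup>-\<^sup>d\<close> times its pairing with the indicator of the cube, whose
  \<open>W\<^bsup>\<alpha>,p'\<^esup>\<close> norm is at most \<open>(C / (\<alpha>p'(1 - \<alpha>p')))\<^bsup>1/p'\<^esup> \<ell>\<^bsup>d/p' - \<alpha>\<^esup>\<close>.  So at scale \<open>3\<^bsup>-j\<^esup>\<close> the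
  coarse-grained matrices grow at most like \<open>3\<^bsup>j(\<alpha> + d/p)\<^esup>\<close>, and the weighted sum of their square roots
  over \<open>j\<close> is a geometric series with ratio \<open>3\<^bsup>-\<sigma>\<^sub>1\<^esup>\<close>.
\<close>

section \<open>The Gagliardo seminorm of a cube\<close>

text \<open>\<open>astar_inv\<close> is a definite description, so it cannot be estimated until a
  unique symmetric matrix is shown to have the defining supremum as its quadratic form. The middle
  of the proof serves this: solutions form a linear space, the supremum of a linear minus a
  quadratic functional over such a space obeys the parallelogram law, and a function with that law,
  quadratic scaling and a quadratic bound is a quadratic form. \<open>cg_norm\<close> is a plain
  supremum and needs only the pointwise inequality. The factors 1/\<gamma> and 1/(1 - \<gamma>),
  with \<gamma> = \<alpha>p', have separate origins: the first is the tail of the kernel at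
  infinity, as the estimates integrate over the whole space, the second its singularity across the
  faces of the cube. At \<gamma> = 0 the constant of the theorem is \<open>top\<close>, yet a zero
  norm makes the product 0 in \<open>ennreal\<close>. Hence everything is first proved with the real
  constant \<open>indicator_const\<close>, and finiteness is read off there.\<close>

text \<open>Convexity: the chord of \<open>exp\<close> between 0 and \<open>- ln 2\<close> lies
  above 2 powr (-\<gamma>). This replaces the sum 1 / (1 - 2 powr (-\<gamma>)) of a dyadic geometric
  series by 2 / \<gamma>.\<close>

lemma half_le_one_minus_two_powr:
  fixes \<gamma> :: real
  assumes "0 \<le> \<gamma>" "\<gamma> \<le> 1"
  shows "\<gamma> / 2 \<le> 1 - 2 powr (-\<gamma>)"
proof -
  have "exp ((1 - \<gamma>) * 0 + \<gamma> * (- ln 2)) \<le> (1 - \<gamma>) * exp 0 + \<gamma> * exp (- ln 2)"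
    using convex_onD[OF exp_convex, of \<gamma> 0 "- ln 2 :: real"] assms by simp
  also have "exp (- ln 2) = (1/2 :: real)"
    by (simp add: exp_minus)
  finally show ?thesis
    by (simp add: powr_def algebra_simps)
qed

lemma suminf_ennreal_geometric:
  fixes c x :: real
  assumes "0 \<le> c" "0 \<le> x" "x < 1"
  shows "(\<Sum>i. ennreal (c * x ^ i)) = ennreal (c / (1 - x))"
proof (rule suminf_ennreal_eq)
  show "(\<lambda>i. c * x ^ i) sums (c / (1 - x))"
    using sums_mult[OF geometric_sums[of x], of c] assms by simp
qed (use assms in simp)

lemma two_power_powr: "(2 ^ i :: real) powr a = (2 powr a) ^ i"
proof -
  have "(2 ^ i :: real) powr a = (2 powr real i) powr a"
    by (simp add: powr_realpow)
  also have "\<dots> = (2 powr a) ^ i"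
    by (simp add: powr_powr powr_power)
  finally show ?thesis .
qed

text \<open>Used to assign a point to its dyadic shell; the index is the predecessor of the least
  power of two that exceeds \<open>t / \<delta>\<close>.\<close>

lemma dyadic_scale_up:
  fixes t \<delta> :: real
  assumes "0 < \<delta>" "\<delta> \<le> t"
  obtains i :: nat where "2 ^ i * \<delta> \<le> t" "t < 2 ^ Suc i * \<delta>"
proof -
  let ?P = "\<lambda>i::nat. t < 2 ^ i * \<delta>"
  obtain n where "t / \<delta> < 2 ^ n"
    using real_arch_pow[of 2 "t / \<delta>"] by auto
  then have "?P n"
    using assms by (simp add: field_simps)
  define m where "m = (LEAST i. ?P i)"
  have m: "?P m"
    unfolding m_def by (rule LeastI) fact
  have "m \<noteq> 0"
    using m assms by (intro notI) simp
  then obtain i where i: "m = Suc i"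
    using not0_implies_Suc by blast
  then have "\<not> ?P i"
    using not_less_Least[of i ?P] m_def by simp
  with m i that show ?thesis
    by (metis linorder_not_less)
qed

lemma emeasure_lborel_cbox_cart:
  fixes l u :: "real^'n"
  assumes "\<And>i. l $ i \<le> u $ i"
  shows "emeasure lborel (cbox l u) = ennreal (\<Prod>i\<in>UNIV. u $ i - l $ i)"
proof -
  have "cbox l u \<noteq> {}"
    using assms by (simp add: interval_ne_empty_cart)
  then show ?thesis
    using content_cbox_cart[of l u] emeasure_eq_ennreal_measure[of lborel "cbox l u"]
      emeasure_lborel_cbox_finite[of l u] by simp
qed

text \<open>Pointwise the integrand is at most the one term whose set covers \<open>x\<close>, hence
  at most the whole series. The sets \<open>S i\<close> may overlap.\<close>

lemma nn_integral_le_suminf_emeasure: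
  fixes c :: "nat \<Rightarrow> real"
  assumes "\<And>i. S i \<in> sets M"
    and "\<And>x. f x \<noteq> 0 \<Longrightarrow> \<exists>i. x \<in> S i \<and> f x \<le> ennreal (c i)"
  shows "(\<integral>\<^sup>+x. f x \<partial>M) \<le> (\<Sum>i. ennreal (c i) * emeasure M (S i))"
proof -
  have "f x \<le> (\<Sum>i. ennreal (c i) * indicator (S i) x)" for x
  proof (cases "f x = 0")
    case False
    then obtain i where i: "x \<in> S i" "f x \<le> ennreal (c i)"
      using assms(2) by blast
    have "(\<Sum>k\<in>{i}. ennreal (c k) * indicator (S k) x) \<le> (\<Sum>i. ennreal (c i) * indicator (S i) x)"
      by (rule sum_le_suminf) auto
    with i show ?thesis
      by (auto intro: order_trans)
  qed simp
  then have "(\<integral>\<^sup>+x. f x \<partial>M) \<le> (\<integral>\<^sup>+x. (\<Sum>i. ennreal (c i) * indicator (S i) x) \<partial>M)"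
    by (intro nn_integral_mono)
  also have "\<dots> = (\<Sum>i. ennreal (c i) * emeasure M (S i))"
    using assms(1) by (subst nn_integral_suminf) (auto intro!: suminf_cong nn_integral_cmult_indicator)
  finally show ?thesis .
qed

text \<open>On the shell of radius about 2^i \<delta> the kernel is at most \<open>c i\<close>, and
  the shell fits in the cube \<open>S i\<close> of side 4 * 2^i \<delta>, whence the factor
  \<open>4 ^ CARD('n)\<close>. The volume cancels all but the power -\<gamma> of the radius, which
  leaves a geometric series of ratio 2 powr (-\<gamma>).\<close>

lemma nn_integral_kernel_off_slab:
  fixes x :: "real^'n" and \<gamma> \<delta> :: real
  assumes "0 < \<gamma>" "\<gamma> \<le> 1" "0 < \<delta>"
  shows "(\<integral>\<^sup>+y. ennreal (norm (x - y) powr (-(real CARD('n) + \<gamma>))) * indicator {y. \<delta> \<le> \<bar>x $ k - y $ k\<bar>} y \<partial>lborel)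
    \<le> ennreal (4 ^ CARD('n) * 2 / \<gamma> * \<delta> powr (-\<gamma>))"
proof -
  let ?n = "real CARD('n)"
  define S where "S i = cbox (x - vec (2 ^ Suc i * \<delta>)) (x + vec (2 ^ Suc i * \<delta>))" for i :: nat
  define c where "c i = (2 ^ i * \<delta>) powr (-(?n + \<gamma>))" for i :: nat
  have "(\<integral>\<^sup>+y. ennreal (norm (x - y) powr (-(?n + \<gamma>))) * indicator {y. \<delta> \<le> \<bar>x $ k - y $ k\<bar>} y \<partial>lborel)
    \<le> (\<Sum>i. ennreal (c i) * emeasure lborel (S i))"
  proof (rule nn_integral_le_suminf_emeasure)
    fix y
    assume "ennreal (norm (x - y) powr (-(?n + \<gamma>))) * indicator {y. \<delta> \<le> \<bar>x $ k - y $ k\<bar>} y \<noteq> 0"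
    then have y: "\<delta> \<le> \<bar>x $ k - y $ k\<bar>"
      by (auto split: split_indicator_asm)
    also have "\<dots> \<le> norm (x - y)"
      using component_le_norm_cart[of "x - y" k] by simp
    finally obtain i where i: "2 ^ i * \<delta> \<le> norm (x - y)" "norm (x - y) < 2 ^ Suc i * \<delta>"
      using dyadic_scale_up[OF assms(3)] by metis
    have "y \<in> S i"
    proof -
      have "\<bar>x $ l - y $ l\<bar> < 2 ^ Suc i * \<delta>" for l
        using component_le_norm_cart[of "x - y" l] i by simp
      then have "x $ l - 2 ^ Suc i * \<delta> \<le> y $ l \<and> y $ l \<le> x $ l + 2 ^ Suc i * \<delta>" for l
        by (smt (verit))
      then show ?thesis
        by (auto simp: S_def mem_box_cart)
    qed
    moreover have "norm (x - y) powr (-(?n + \<gamma>)) \<le> c i"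
      unfolding c_def using i assms by (intro powr_mono2') auto
    ultimately show "\<exists>i. y \<in> S i \<and> ennreal (norm (x - y) powr (-(?n + \<gamma>))) * indicator {y. \<delta> \<le> \<bar>x $ k - y $ k\<bar>} y \<le> ennreal (c i)"
      using y by (auto intro!: exI[of _ i] ennreal_leI)
  qed (simp add: S_def)
  also have "\<dots> = (\<Sum>i. ennreal (4 ^ CARD('n) * \<delta> powr (-\<gamma>) * (2 powr (-\<gamma>)) ^ i))"
  proof (rule suminf_cong)
    fix i
    have "emeasure lborel (S i) = ennreal ((2 ^ Suc i * \<delta> * 2) ^ CARD('n))"
      unfolding S_def using assms by (subst emeasure_lborel_cbox_cart) (auto simp: mult.commute)
    moreover have "c i * (2 ^ Suc i * \<delta> * 2) ^ CARD('n) = 4 ^ CARD('n) * \<delta> powr (-\<gamma>) * (2 powr (-\<gamma>)) ^ i"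
    proof -
      define W where "W = (2 ^ i * \<delta>) ^ CARD('n)"
      have "W \<noteq> 0"
        using assms by (simp add: W_def)
      moreover have "c i = (2 ^ i * \<delta>) powr (-\<gamma>) / W"
      proof -
        have "-(?n + \<gamma>) = -\<gamma> - ?n"
          by simp
        then have "c i = (2 ^ i * \<delta>) powr (-\<gamma>) / (2 ^ i * \<delta>) powr ?n"
          by (simp only: c_def powr_diff)
        then show ?thesis
          using assms by (simp add: W_def powr_realpow)
      qed
      moreover have "(2 ^ Suc i * \<delta> * 2) ^ CARD('n) = 4 ^ CARD('n) * W"
      proof -
        have "2 ^ Suc i * \<delta> * 2 = 4 * (2 ^ i * \<delta>)"
          by simp
        then show ?thesis
          by (simp only: power_mult_distrib W_def)
      qed
      moreover have "(2 ^ i * \<delta>) powr (-\<gamma>) = (2 powr (-\<gamma>)) ^ i * \<delta> powr (-\<gamma>)"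
        using assms by (simp add: powr_mult two_power_powr)
      ultimately show ?thesis
        using assms by simp
    qed
    ultimately show "ennreal (c i) * emeasure lborel (S i) = ennreal (4 ^ CARD('n) * \<delta> powr (-\<gamma>) * (2 powr (-\<gamma>)) ^ i)"
      using assms by (simp add: c_def flip: ennreal_mult)
  qed
  also have "\<dots> = ennreal (4 ^ CARD('n) * \<delta> powr (-\<gamma>) / (1 - 2 powr (-\<gamma>)))"
    using assms by (intro suminf_ennreal_geometric) (auto simp: powr_minus inverse_less_1_iff)
  also have "\<dots> \<le> ennreal (4 ^ CARD('n) * \<delta> powr (-\<gamma>) / (\<gamma> / 2))"
    using assms half_le_one_minus_two_powr[of \<gamma>]
    by (intro ennreal_leI divide_left_mono) auto
  finally show ?thesis
    by (simp add: field_simps)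
qed


lemma emeasure_cube_slab_le:
  fixes z :: "real^'n"
  assumes "0 \<le> \<tau>" "\<tau> \<le> h"
  shows "emeasure lborel {x \<in> cbox (z - vec h) (z + vec h). h - \<tau> \<le> \<bar>x $ k - z $ k\<bar>}
    \<le> ennreal (2 * \<tau> * (2 * h) ^ (CARD('n) - 1))"
proof -
  \<comment> \<open>\<open>A\<close> and \<open>B\<close> are the layers of thickness \<tau> along
    the two faces orthogonal to axis \<open>k\<close>.\<close>
  define A where "A = cbox (\<chi> i. if i = k then z $ i + h - \<tau> else z $ i - h) (z + vec h)"
  define B where "B = cbox (z - vec h) (\<chi> i. if i = k then z $ i - h + \<tau> else z $ i + h)"
  have prod: "(\<Prod>i\<in>UNIV. if i = k then \<tau> else 2 * h) = \<tau> * (2 * h) ^ (CARD('n) - 1)"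
    by (subst prod.remove[of _ k]) (auto simp: card_Diff_singleton)
  have eA: "emeasure lborel A = ennreal (\<tau> * (2 * h) ^ (CARD('n) - 1))"
    unfolding A_def using assms
    by (subst emeasure_lborel_cbox_cart, simp, subst prod[symmetric])
       (auto intro!: arg_cong[where f=ennreal] prod.cong)
  have eB: "emeasure lborel B = ennreal (\<tau> * (2 * h) ^ (CARD('n) - 1))"
    unfolding B_def using assms
    by (subst emeasure_lborel_cbox_cart, simp, subst prod[symmetric])
       (auto intro!: arg_cong[where f=ennreal] prod.cong)
  have "{x \<in> cbox (z - vec h) (z + vec h). h - \<tau> \<le> \<bar>x $ k - z $ k\<bar>} \<subseteq> A \<union> B"
  proof
    fix x assume x: "x \<in> {x \<in> cbox (z - vec h) (z + vec h). h - \<tau> \<le> \<bar>x $ k - z $ k\<bar>}"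
    then have "h - \<tau> \<le> x $ k - z $ k \<or> h - \<tau> \<le> z $ k - x $ k"
      by auto
    with x show "x \<in> A \<union> B"
      unfolding A_def B_def by (auto simp: mem_box_cart)
  qed
  then have "emeasure lborel {x \<in> cbox (z - vec h) (z + vec h). h - \<tau> \<le> \<bar>x $ k - z $ k\<bar>}
    \<le> emeasure lborel (A \<union> B)"
    by (rule emeasure_mono) (simp add: A_def B_def)
  also have "\<dots> \<le> emeasure lborel A + emeasure lborel B"
    by (rule emeasure_subadditive) (simp_all add: A_def B_def)
  also have "\<dots> = ennreal (2 * \<tau> * (2 * h) ^ (CARD('n) - 1))"
    unfolding eA eB using assms by (subst ennreal_plus[symmetric]) (auto simp: mult_ac)
  finally show ?thesis .
qed

text \<open>Decomposes by the distance to the nearer face orthogonal to axis \<open>k\<close>. The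
  layer of distance at most h/2^i has measure of order 2^-i and carries a weight of order
  2^(i\<gamma>); the series converges because \<gamma> < 1.\<close>

lemma nn_integral_face_distance:
  fixes z :: "real^'n" and \<gamma> h :: real
  assumes "0 \<le> \<gamma>" "\<gamma> < 1" "0 < h"
  shows "(\<integral>\<^sup>+x. ennreal ((h - \<bar>x $ k - z $ k\<bar>) powr (-\<gamma>)) * indicator (box (z - vec h) (z + vec h)) x \<partial>lborel)
    \<le> ennreal (8 / (1 - \<gamma>) * (2 * h) powr (real CARD('n) - \<gamma>))"
proof -
  define Q where "Q = box (z - vec h) (z + vec h)"
  define S where "S i = {x \<in> cbox (z - vec h) (z + vec h). h - h / 2 ^ i \<le> \<bar>x $ k - z $ k\<bar>}" for i :: nat
  \<comment> \<open>At the index chosen below the distance exceeds \<open>h / 2 ^ Suc i\<close>, one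
    halving beyond the layer \<open>S i\<close>.\<close>
  define c where "c i = (h / 2 ^ Suc i) powr (-\<gamma>)" for i :: nat
  have "(\<integral>\<^sup>+x. ennreal ((h - \<bar>x $ k - z $ k\<bar>) powr (-\<gamma>)) * indicator Q x \<partial>lborel)
    \<le> (\<Sum>i. ennreal (c i) * emeasure lborel (S i))"
  proof (rule nn_integral_le_suminf_emeasure)
    fix x
    assume "ennreal ((h - \<bar>x $ k - z $ k\<bar>) powr (-\<gamma>)) * indicator Q x \<noteq> 0"
    then have x: "x \<in> Q"
      by (auto split: split_indicator_asm)
    define t where "t = h - \<bar>x $ k - z $ k\<bar>"
    have t: "0 < t" "t \<le> h"
    proof -
      have "z $ k - h < x $ k" "x $ k < z $ k + h"
        using x by (auto simp: Q_def mem_box_cart)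
      then show "0 < t" "t \<le> h"
        by (auto simp: t_def)
    qed
    obtain i where i: "2 ^ i * t \<le> h" "h < 2 ^ Suc i * t"
      using dyadic_scale_up[OF t] by metis
    have "x \<in> S i"
      using i x by (auto simp: S_def t_def Q_def field_simps mem_box_cart less_imp_le)
    moreover have "t powr (-\<gamma>) \<le> c i"
      unfolding c_def using i t assms by (intro powr_mono2') (auto simp: field_simps)
    ultimately show "\<exists>i. x \<in> S i \<and> ennreal ((h - \<bar>x $ k - z $ k\<bar>) powr (-\<gamma>)) * indicator Q x \<le> ennreal (c i)"
      using x by (auto intro!: exI[of _ i] ennreal_leI simp: t_def)
  next
    fix i show "S i \<in> sets lborel"
      unfolding S_def by measurable
  qed
  also have "\<dots> \<le> (\<Sum>i. ennreal (2 powr \<gamma> * h powr (-\<gamma>) * (2 * h) ^ CARD('n) * (2 powr (-(1 - \<gamma>))) ^ i))"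
  proof (rule suminf_le)
    fix i
    have "ennreal (c i) * emeasure lborel (S i) \<le> ennreal (c i) * ennreal (2 * (h / 2 ^ i) * (2 * h) ^ (CARD('n) - 1))"
      unfolding S_def using assms by (intro mult_left_mono emeasure_cube_slab_le) (auto simp: field_simps)
    also have "\<dots> = ennreal (c i * (2 * (h / 2 ^ i) * (2 * h) ^ (CARD('n) - 1)))"
      using assms by (simp add: c_def flip: ennreal_mult)
    also have "c i * (2 * (h / 2 ^ i) * (2 * h) ^ (CARD('n) - 1)) = 2 powr \<gamma> * h powr (-\<gamma>) * (2 * h) ^ CARD('n) * (2 powr (-(1 - \<gamma>))) ^ i"
    proof -
      have "(2 * h) ^ CARD('n) = 2 * h * (2 * h) ^ (CARD('n) - 1)"
        by (simp add: power_eq_if)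
      moreover have "c i = 2 powr \<gamma> * (2 powr \<gamma>) ^ i * h powr (-\<gamma>)"
      proof -
        have "(2 ^ Suc i) powr \<gamma> = 2 powr \<gamma> * (2 powr \<gamma>) ^ i"
          using two_power_powr[of "Suc i" \<gamma>] by simp
        then show ?thesis
          using assms by (simp add: c_def powr_divide powr_minus field_simps)
      qed
      moreover have "(2 powr (-(1 - \<gamma>))) ^ i = (2 powr \<gamma>) ^ i / 2 ^ i"
        by (simp add: powr_diff power_divide)
      ultimately show ?thesis
        by simp
    qed
    finally show "ennreal (c i) * emeasure lborel (S i) \<le> ennreal (2 powr \<gamma> * h powr (-\<gamma>) * (2 * h) ^ CARD('n) * (2 powr (-(1 - \<gamma>))) ^ i)" .
  qed auto
  also have "\<dots> = ennreal (2 powr \<gamma> * h powr (-\<gamma>) * (2 * h) ^ CARD('n) / (1 - 2 powr (-(1 - \<gamma>))))"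
    using assms powr_less_mono[of "-(1-\<gamma>)" 0 2] by (intro suminf_ennreal_geometric) auto
  also have "\<dots> \<le> ennreal (8 / (1 - \<gamma>) * (2 * h) powr (real CARD('n) - \<gamma>))"
  proof (rule ennreal_leI)
    have "2 powr \<gamma> * h powr (-\<gamma>) * (2 * h) ^ CARD('n) / (1 - 2 powr (-(1 - \<gamma>)))
      \<le> 2 powr \<gamma> * h powr (-\<gamma>) * (2 * h) ^ CARD('n) / ((1 - \<gamma>) / 2)"
      using assms half_le_one_minus_two_powr[of "1 - \<gamma>"] by (intro divide_left_mono) auto
    also have "2 powr \<gamma> * h powr (-\<gamma>) * (2 * h) ^ CARD('n) / ((1 - \<gamma>) / 2)
      = 2 powr \<gamma> * 2 powr \<gamma> * (2 * h) powr (real CARD('n) - \<gamma>) / ((1 - \<gamma>) / 2)"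
      using assms by (simp add: powr_diff powr_mult powr_minus powr_realpow power_mult_distrib field_simps)
    \<comment> \<open>One factor 2 powr \<gamma> comes from the extra halving in \<open>c\<close>,
      the other from writing \<open>h\<close> in terms of the side \<open>2 * h\<close>; each is at
      most 2. With the 2 from \<open>half_le_one_minus_two_powr\<close> this makes the 8.\<close>
    also have "\<dots> \<le> 4 * (2 * h) powr (real CARD('n) - \<gamma>) / ((1 - \<gamma>) / 2)"
    proof -
      have "2 powr \<gamma> \<le> (2::real)"
        using assms powr_mono[of \<gamma> 1 2] by simp
      then have "2 powr \<gamma> * 2 powr \<gamma> \<le> (2 * 2 :: real)"
        by (intro mult_mono) auto
      then show ?thesis
        using assms by (intro divide_right_mono mult_right_mono) auto
    qed
    also have "\<dots> = 8 / (1 - \<gamma>) * (2 * h) powr (real CARD('n) - \<gamma>)"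
      by simp
    finally show "2 powr \<gamma> * h powr (-\<gamma>) * (2 * h) ^ CARD('n) / (1 - 2 powr (-(1 - \<gamma>)))
      \<le> 8 / (1 - \<gamma>) * (2 * h) powr (real CARD('n) - \<gamma>)" .
  qed
  finally show ?thesis
    unfolding Q_def .
qed


text \<open>A point outside the box fails in some coordinate \<open>k\<close>, and there differs
  from \<open>x\<close> by at least \<open>?D k x\<close>, the distance of \<open>x\<close> to the
  faces orthogonal to axis \<open>k\<close>. So the inner integral is at most a sum of off-slab
  integrals, and the outer one reduces to \<open>nn_integral_face_distance\<close>. In the constant,
  16 = 2 * 8 and \<open>CARD('n)\<close> counts the directions.\<close>

lemma nn_integral_kernel_cube_complement:
  fixes z :: "real^'n" and \<gamma> h :: real
  assumes "0 < \<gamma>" "\<gamma> < 1" "0 < h"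
  defines "Q \<equiv> box (z - vec h) (z + vec h)"
  shows "(\<integral>\<^sup>+x. (\<integral>\<^sup>+y. ennreal (norm (x - y) powr (-(real CARD('n) + \<gamma>))) * indicator (Q \<times> - Q) (x, y) \<partial>lborel) \<partial>lborel)
    \<le> ennreal (16 * real CARD('n) * 4 ^ CARD('n) / (\<gamma> * (1 - \<gamma>)) * (2 * h) powr (real CARD('n) - \<gamma>))"
proof -
  let ?K = "\<lambda>x y::real^'n. ennreal (norm (x - y) powr (-(real CARD('n) + \<gamma>)))"
  let ?D = "\<lambda>k x. h - \<bar>x $ k - z $ k\<bar>"
  let ?c = "4 ^ CARD('n) * 2 / \<gamma>"
  have inner: "(\<integral>\<^sup>+y. ?K x y * indicator (Q \<times> - Q) (x, y) \<partial>lborel)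
    \<le> (\<Sum>k\<in>UNIV. ennreal ?c * (ennreal (?D k x powr (-\<gamma>)) * indicator Q x))" for x
  proof (cases "x \<in> Q")
    case True
    then have D: "0 < ?D k x" for k
      by (auto simp: Q_def mem_box_cart abs_less_iff algebra_simps)
    have "?K x y * indicator (Q \<times> - Q) (x, y) \<le> (\<Sum>k\<in>UNIV. ?K x y * indicator {y. ?D k x \<le> \<bar>x $ k - y $ k\<bar>} y)" for y
    proof (cases "y \<in> Q")
      case False
      then obtain k where k: "\<not> (z $ k - h < y $ k \<and> y $ k < z $ k + h)"
        by (auto simp: Q_def mem_box_cart)
      then have "?D k x \<le> \<bar>x $ k - y $ k\<bar>"
        by auto
      then have "?K x y * indicator (Q \<times> - Q) (x, y) \<le> ?K x y * indicator {y. ?D k x \<le> \<bar>x $ k - y $ k\<bar>} y"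
        by (auto split: split_indicator)
      also have "\<dots> \<le> (\<Sum>k\<in>UNIV. ?K x y * indicator {y. ?D k x \<le> \<bar>x $ k - y $ k\<bar>} y)"
        by (rule member_le_sum[where f="\<lambda>k. ?K x y * indicator {y. ?D k x \<le> \<bar>x $ k - y $ k\<bar>} y"]) auto
      finally show ?thesis .
    qed simp
    then have "(\<integral>\<^sup>+y. ?K x y * indicator (Q \<times> - Q) (x, y) \<partial>lborel)
        \<le> (\<integral>\<^sup>+y. (\<Sum>k\<in>UNIV. ?K x y * indicator {y. ?D k x \<le> \<bar>x $ k - y $ k\<bar>} y) \<partial>lborel)"
      by (intro nn_integral_mono)
    also have "\<dots> = (\<Sum>k\<in>UNIV. \<integral>\<^sup>+y. ?K x y * indicator {y. ?D k x \<le> \<bar>x $ k - y $ k\<bar>} y \<partial>lborel)"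
      by (intro nn_integral_sum) measurable
    also have "\<dots> \<le> (\<Sum>k\<in>UNIV. ennreal (?c * ?D k x powr (-\<gamma>)))"
      using assms D by (intro sum_mono nn_integral_kernel_off_slab) auto
    also have "\<dots> = (\<Sum>k\<in>UNIV. ennreal ?c * (ennreal (?D k x powr (-\<gamma>)) * indicator Q x))"
      using True assms by (intro sum.cong) (auto simp flip: ennreal_mult)
    finally show ?thesis .
  qed simp
  have "(\<integral>\<^sup>+x. (\<integral>\<^sup>+y. ?K x y * indicator (Q \<times> - Q) (x, y) \<partial>lborel) \<partial>lborel)
    \<le> (\<integral>\<^sup>+x. (\<Sum>k\<in>UNIV. ennreal ?c * (ennreal (?D k x powr (-\<gamma>)) * indicator Q x)) \<partial>lborel)"
    by (intro nn_integral_mono inner)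
  also have "\<dots> = (\<Sum>k\<in>UNIV. ennreal ?c * (\<integral>\<^sup>+x. ennreal (?D k x powr (-\<gamma>)) * indicator Q x \<partial>lborel))"
    by (subst nn_integral_sum) (auto simp: Q_def intro!: sum.cong nn_integral_cmult)
  also have "\<dots> \<le> (\<Sum>k\<in>(UNIV :: 'n set). ennreal ?c * ennreal (8 / (1 - \<gamma>) * (2 * h) powr (real CARD('n) - \<gamma>)))"
    unfolding Q_def using assms by (intro sum_mono mult_left_mono nn_integral_face_distance) auto
  also have "\<dots> = ennreal (16 * real CARD('n) * 4 ^ CARD('n) / (\<gamma> * (1 - \<gamma>)) * (2 * h) powr (real CARD('n) - \<gamma>))"
    using assms by (simp add: ennreal_of_nat_eq_real_of_nat flip: ennreal_mult)
  finally show ?thesis .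
qed

section \<open>Sobolev norms of indicators of cubes\<close>

lemma nn_integral_lebesgue_on_le_lborel:
  assumes "U \<in> sets lebesgue"
  shows "(\<integral>\<^sup>+x. f x \<partial>lebesgue_on U) \<le> (\<integral>\<^sup>+x. f x \<partial>lborel)"
proof -
  have "(\<integral>\<^sup>+x. f x \<partial>lebesgue_on U) = (\<integral>\<^sup>+x. f x * indicator U x \<partial>lebesgue)"
    using assms by (intro nn_integral_restrict_space) auto
  also have "\<dots> \<le> (\<integral>\<^sup>+x. f x \<partial>lebesgue)"
    by (intro nn_integral_mono) (auto split: split_indicator)
  finally show ?thesis
    by (simp only: nn_integral_completion)
qed

lemma ennpow_mono:
  assumes "0 \<le> r" "x \<le> y"
  shows "ennpow x r \<le> ennpow y r"
proof (cases "y = top")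
  case False
  then have "y < top"
    by (simp add: less_top)
  then have "enn2real x \<le> enn2real y" "x \<noteq> top"
    using assms(2) by (auto intro: enn2real_mono simp: top_unique)
  with False assms(1) show ?thesis
    by (simp add: ennpow_def ennreal_leI powr_mono2)
qed (simp add: ennpow_def)

lemma ennpow_ennreal: "0 \<le> x \<Longrightarrow> ennpow (ennreal x) r = ennreal (x powr r)"
  by (simp add: ennpow_def)

text \<open>Here \<open>\<gamma> = \<alpha>r\<close>; the case \<open>\<gamma> = 0\<close> is the \<open>L\<^sup>r\<close> norm, where no Gagliardo seminorm occurs.\<close>

definition indicator_const :: "nat \<Rightarrow> real \<Rightarrow> real"
  where "indicator_const n \<gamma> = (if \<gamma> = 0 then 1 else (1 + 32 * real n * 4 ^ n) / (\<gamma> * (1 - \<gamma>)))"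

lemma indicator_const_pos: "0 \<le> \<gamma> \<Longrightarrow> \<gamma> < 1 \<Longrightarrow> 0 < indicator_const n \<gamma>"
  by (auto simp: indicator_const_def intro!: divide_pos_pos add_pos_nonneg)

lemma emeasure_lborel_cube:
  fixes z :: "real^'n"
  assumes "0 < h"
  shows "emeasure lborel (box (z - vec h) (z + vec h)) = ennreal ((2 * h) ^ CARD('n))"
proof -
  have "emeasure lborel (box (z - vec h) (z + vec h)) = emeasure lborel (cbox (z - vec h) (z + vec h))"
    by (simp add: emeasure_lborel_box_eq emeasure_lborel_cbox_eq)
  then show ?thesis
    using assms by (simp add: emeasure_lborel_cbox_cart mult.commute)
qed

text \<open>The values at two points differ only if exactly one of them lies in \<open>Q\<close>, so
  by symmetry the double integral is at most twice that of
  \<open>nn_integral_kernel_cube_complement\<close>. The factor \<kappa> is carried along so that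
  the function can be normalised later.\<close>

lemma sobolev_norm_indicator_cube:
  fixes z :: "real^'n" and \<alpha> r h \<kappa> :: real
  assumes "U \<in> sets lebesgue" "0 < r" "0 \<le> \<alpha>" "\<alpha> * r < 1" "0 < h" "2 * h \<le> 1" "0 \<le> \<kappa>"
  defines "Q \<equiv> box (z - vec h) (z + vec h)"
  shows "sobolev_norm U \<alpha> r (\<lambda>x. \<kappa> * indicator Q x)
    \<le> ennreal ((\<kappa> powr r * (indicator_const CARD('n) (\<alpha> * r) * (2 * h) powr (real CARD('n) - \<alpha> * r))) powr (1 / r))"
proof -
  let ?n = "real CARD('n)" and ?\<gamma> = "\<alpha> * r" and ?f = "\<lambda>x. \<kappa> * indicator Q x :: real"
  let ?V = "(2 * h) powr (?n - ?\<gamma>)"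
  let ?C = "16 * ?n * 4 ^ CARD('n) / (?\<gamma> * (1 - ?\<gamma>))"
  define F where "F xy = ennreal (norm (fst xy - snd xy) powr (-(?n + ?\<gamma>))) * indicator (Q \<times> - Q) xy" for xy :: "(real^'n) \<times> (real^'n)"
  have \<gamma>: "0 \<le> ?\<gamma>"
    using assms by simp
  have "(\<integral>\<^sup>+x. ennreal (\<bar>?f x\<bar> powr r) \<partial>lebesgue_on U) \<le> (\<integral>\<^sup>+x. ennreal (\<bar>?f x\<bar> powr r) \<partial>lborel)"
    using assms(1) by (rule nn_integral_lebesgue_on_le_lborel)
  also have "\<dots> = (\<integral>\<^sup>+x. ennreal (\<kappa> powr r) * indicator Q x \<partial>lborel)"
    using assms by (intro nn_integral_cong) (auto split: split_indicator)
  also have "\<dots> = ennreal (\<kappa> powr r) * emeasure lborel Q"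
    by (intro nn_integral_cmult_indicator) (simp add: Q_def)
  also have "\<dots> = ennreal (\<kappa> powr r * (2 * h) powr ?n)"
    using assms by (simp add: emeasure_lborel_cube powr_realpow ennreal_mult)
  \<comment> \<open>As \<open>2 * h \<le> 1\<close>, lowering the exponent increases the power,
    which brings the \<open>L\<^sup>r\<close> part to the same power of the side as the
    seminorm.\<close>
  also have "\<dots> \<le> ennreal (\<kappa> powr r * ?V)"
    using assms \<gamma> by (intro ennreal_leI mult_left_mono powr_mono') auto
  finally have Lr: "(\<integral>\<^sup>+x. ennreal (\<bar>?f x\<bar> powr r) \<partial>lebesgue_on U) \<le> ennreal (\<kappa> powr r * ?V)" .
  have total: "(\<integral>\<^sup>+x. ennreal (\<bar>?f x\<bar> powr r) \<partial>lebesgue_on U) +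
      (if \<alpha> = 0 then 0
       else \<integral>\<^sup>+x. (\<integral>\<^sup>+y. ennreal (\<bar>?f x - ?f y\<bar> powr r / norm (x - y) powr (?n + \<alpha> * r))
              \<partial>lebesgue_on U) \<partial>lebesgue_on U)
    \<le> ennreal (\<kappa> powr r * (indicator_const CARD('n) ?\<gamma> * ?V))"
  proof (cases "\<alpha> = 0")
    case True
    then show ?thesis
      using Lr by (simp add: indicator_const_def)
  next
    case False
    then have \<gamma>: "0 < ?\<gamma>"
      using assms by simp
    have K[measurable]: "F \<in> borel_measurable (lborel \<Otimes>\<^sub>M lborel)"
      unfolding F_def Q_def by measurable
    have K1: "(\<integral>\<^sup>+x. (\<integral>\<^sup>+y. F (x, y) \<partial>lborel) \<partial>lborel) \<le> ennreal (?C * ?V)"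
      unfolding F_def fst_conv snd_conv Q_def using assms \<gamma> by (intro nn_integral_kernel_cube_complement) auto
    have K2: "(\<integral>\<^sup>+x. (\<integral>\<^sup>+y. F (y, x) \<partial>lborel) \<partial>lborel) \<le> ennreal (?C * ?V)"
      using lborel_pair.Fubini'[of "\<lambda>x y. F (x, y)"] K1 by simp
    have "(\<integral>\<^sup>+x. (\<integral>\<^sup>+y. ennreal (\<bar>?f x - ?f y\<bar> powr r / norm (x - y) powr (?n + ?\<gamma>)) \<partial>lebesgue_on U) \<partial>lebesgue_on U)
      \<le> (\<integral>\<^sup>+x. (\<integral>\<^sup>+y. ennreal (\<bar>?f x - ?f y\<bar> powr r / norm (x - y) powr (?n + ?\<gamma>)) \<partial>lborel) \<partial>lborel)"
      using assms(1)
      by (intro order_trans[OF nn_integral_lebesgue_on_le_lborel] nn_integral_mono nn_integral_lebesgue_on_le_lborel)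
    also have "\<dots> = (\<integral>\<^sup>+x. (\<integral>\<^sup>+y. ennreal (\<kappa> powr r) * (F (x, y) + F (y, x)) \<partial>lborel) \<partial>lborel)"
      unfolding F_def fst_conv snd_conv powr_minus_divide using assms
      by (intro nn_integral_cong)
         (auto split: split_indicator simp: norm_minus_commute simp flip: ennreal_mult)
    also have "\<dots> = ennreal (\<kappa> powr r) * ((\<integral>\<^sup>+x. (\<integral>\<^sup>+y. F (x, y) \<partial>lborel) \<partial>lborel) + (\<integral>\<^sup>+x. (\<integral>\<^sup>+y. F (y, x) \<partial>lborel) \<partial>lborel))"
      by (simp add: nn_integral_cmult nn_integral_add)
    also have "\<dots> \<le> ennreal (\<kappa> powr r) * (ennreal (?C * ?V) + ennreal (?C * ?V))"
      by (intro mult_left_mono add_mono K1 K2) auto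
    also have "\<dots> = ennreal (\<kappa> powr r * (2 * ?C * ?V))"
      using assms \<gamma> by (simp flip: ennreal_mult ennreal_plus)
    finally have "(\<integral>\<^sup>+x. (\<integral>\<^sup>+y. ennreal (\<bar>?f x - ?f y\<bar> powr r / norm (x - y) powr (?n + ?\<gamma>)) \<partial>lebesgue_on U) \<partial>lebesgue_on U)
      \<le> ennreal (\<kappa> powr r * (2 * ?C * ?V))" .
    with Lr have "(\<integral>\<^sup>+x. ennreal (\<bar>?f x\<bar> powr r) \<partial>lebesgue_on U) +
      (\<integral>\<^sup>+x. (\<integral>\<^sup>+y. ennreal (\<bar>?f x - ?f y\<bar> powr r / norm (x - y) powr (?n + ?\<gamma>)) \<partial>lebesgue_on U) \<partial>lebesgue_on U)
      \<le> ennreal (\<kappa> powr r * ?V) + ennreal (\<kappa> powr r * (2 * ?C * ?V))"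
      by (rule add_mono)
    also have "\<dots> = ennreal (\<kappa> powr r * ((1 + 2 * ?C) * ?V))"
    proof -
      have "0 \<le> \<kappa> powr r * ?V" "0 \<le> \<kappa> powr r * (2 * ?C * ?V)"
        using assms \<gamma> by auto
      then show ?thesis
        by (simp only: distrib_right distrib_left mult_1 flip: ennreal_plus)
    qed
    also have "\<dots> \<le> ennreal (\<kappa> powr r * (indicator_const CARD('n) ?\<gamma> * ?V))"
    proof (intro ennreal_leI mult_left_mono mult_right_mono)
      \<comment> \<open>Since \<gamma>(1 - \<gamma>) is at most 1, the 1 contributed by the
        \<open>L\<^sup>r\<close> part can be put over the same denominator.\<close>
      have "?\<gamma> * (1 - ?\<gamma>) \<le> 1 * 1"
        using assms \<gamma> by (intro mult_mono) auto
      moreover have "0 < ?\<gamma> * (1 - ?\<gamma>)"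
        using assms \<gamma> by simp
      ultimately have "1 \<le> 1 / (?\<gamma> * (1 - ?\<gamma>))"
        by (simp only: le_divide_eq_1_pos mult_1)
      moreover have "indicator_const CARD('n) ?\<gamma> = 1 / (?\<gamma> * (1 - ?\<gamma>)) + 2 * ?C"
        using \<gamma> by (auto simp: indicator_const_def add_divide_distrib)
      ultimately show "1 + 2 * ?C \<le> indicator_const CARD('n) ?\<gamma>"
        by linarith
    qed auto
    finally show ?thesis
      using False by simp
  qed
  have "0 \<le> \<kappa> powr r * (indicator_const CARD('n) ?\<gamma> * ?V)"
    using assms \<gamma> indicator_const_pos[of ?\<gamma> "CARD('n)"] by simp
  then show ?thesis
    unfolding sobolev_norm_def using ennpow_mono[OF _ total, of "1 / r"] assms(2)
    by (simp add: ennpow_ennreal)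
qed

section \<open>Averages over cubes in negative Sobolev spaces\<close>

text \<open>The dual norm is a real supremum and bounds its members only if they are bounded above;
  the continuity constant \<open>B\<close> of the functional supplies this. It may be negative,
  hence \<open>\<bar>B\<bar>\<close>.\<close>

lemma abs_le_sobolev_dual_norm:
  assumes "L \<in> sobolev_dual U \<alpha> r" "f \<in> sobolev_space U \<alpha> r" "sobolev_norm U \<alpha> r f \<le> 1"
  shows "\<bar>L f\<bar> \<le> sobolev_dual_norm U \<alpha> r L"
proof -
  obtain B where B: "\<And>f. f \<in> sobolev_space U \<alpha> r \<Longrightarrow> \<bar>L f\<bar> \<le> B * enn2real (sobolev_norm U \<alpha> r f)"
    using assms(1) unfolding sobolev_dual_def by blast
  have "\<bar>L g\<bar> \<le> \<bar>B\<bar>" if g: "g \<in> sobolev_space U \<alpha> r" "sobolev_norm U \<alpha> r g \<le> 1" for g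
  proof -
    have "\<bar>L g\<bar> \<le> B * enn2real (sobolev_norm U \<alpha> r g)"
      using B g by blast
    also have "\<dots> \<le> \<bar>B\<bar> * 1"
      using enn2real_mono[OF g(2)] by (intro mult_mono) auto
    finally show ?thesis
      by simp
  qed
  then show ?thesis
    unfolding sobolev_dual_norm_def using assms
    by (intro cSUP_upper bdd_aboveI2[where M="\<bar>B\<bar>"]) auto
qed

lemma measure_lebesgue_cube:
  fixes z :: "real^'n"
  assumes "0 < h"
  shows "measure lebesgue (box (z - vec h) (z + vec h)) = (2 * h) ^ CARD('n)"
  using emeasure_lborel_cube[OF assms, of z] assms by (simp add: measure_def)

text \<open>Tests the functional with a multiple of the indicator of \<open>Q\<close> that lies in
  the unit ball; this function is bounded, so the pairing is an actual integral. The power of the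
  side is (n - \<alpha>p')/p' - n = -(\<alpha> + n/p).\<close>

lemma neg_sobolev_average_cube_le:
  fixes z :: "real^'n" and \<alpha> p h :: real and f :: "real^'n \<Rightarrow> real"
  assumes f: "in_neg_sobolev U \<alpha> p f" and U: "U \<in> sets lebesgue"
    and "1 < p" "0 \<le> \<alpha>" "\<alpha> < 1 - 1 / p" "0 < h" "2 * h \<le> 1"
  defines "Q \<equiv> box (z - vec h) (z + vec h)" and "p' \<equiv> p / (p - 1)"
  assumes "Q \<subseteq> U"
  shows "\<bar>average Q f\<bar> \<le> indicator_const CARD('n) (\<alpha> * p') powr (1 / p')
    * (2 * h) powr (- (\<alpha> + real CARD('n) / p)) * neg_sobolev_norm U \<alpha> p f"
proof -
  let ?n = "real CARD('n)"
  \<comment> \<open>The same choice of representative as in \<open>neg_sobolev_norm\<close>.\<close>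
  define L where "L = (SOME L. represents U \<alpha> p' f L)"
  have L: "represents U \<alpha> p' f L"
    using f someI_ex[of "represents U \<alpha> p' f"] by (simp add: in_neg_sobolev_def L_def p'_def)
  define X where "X = indicator_const CARD('n) (\<alpha> * p') * (2 * h) powr (?n - \<alpha> * p')"
  \<comment> \<open>\<open>X\<close> bounds the \<open>p'\<close>-th power of the norm of the
    indicator, so that \<open>\<kappa> powr p' * X = 1\<close> normalises it.\<close>
  define \<kappa> where "\<kappa> = X powr (- 1 / p')"
  define g where "g = (\<lambda>x. \<kappa> * indicator Q x :: real)"
  have p': "0 < p'" "1 / p' = 1 - 1 / p"
    using assms by (auto simp: p'_def field_simps)
  have "\<alpha> < 1 / p'"
    using assms(5) p'(2) by simp
  then have \<gamma>: "0 \<le> \<alpha> * p'" "\<alpha> * p' < 1"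
    using assms(4) p'(1) by (simp_all add: pos_less_divide_eq)
  have X: "0 < X"
    using assms indicator_const_pos[OF \<gamma>] by (simp add: X_def)
  have "\<kappa> powr p' = X powr (-1)"
    unfolding \<kappa>_def powr_powr using p'(1) by simp
  then have "\<kappa> powr p' * X = 1"
    using X by (simp add: powr_minus)
  moreover have "0 < \<kappa>"
    using X by (simp add: \<kappa>_def)
  ultimately have norm_g: "sobolev_norm U \<alpha> p' g \<le> 1"
    using sobolev_norm_indicator_cube[OF U p'(1) assms(4) \<gamma>(2) assms(6,7), of \<kappa> z]
    by (simp add: g_def X_def Q_def)
  have "g \<in> borel_measurable (lebesgue_on U)"
    unfolding g_def Q_def
    by (intro borel_measurable_times borel_measurable_indicator measurable_restrict_space1) auto
  then have g: "g \<in> sobolev_space U \<alpha> p'"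
    using norm_g by (auto simp: sobolev_space_def intro: le_less_trans)
  have "bounded (g ` U)"
    by (rule finite_imp_bounded, rule finite_subset[of _ "{0, \<kappa>}"]) (auto simp: g_def indicator_def)
  then have Lg: "L g = (\<integral>x. f x * g x \<partial>lebesgue_on U)"
    using L g by (auto simp: represents_def)
  have "Q \<in> sets lebesgue"
    by (simp add: Q_def)
  then have "(\<integral>x. f x * g x \<partial>lebesgue_on U) = \<kappa> * (\<integral>x. f x \<partial>lebesgue_on Q)"
    using U \<open>Q \<subseteq> U\<close> unfolding integral_mult_right_zero[symmetric]
    by (subst (1 2) integral_restrict_space)
       (auto simp: g_def intro!: Bochner_Integration.integral_cong split: split_indicator)
  with Lg have "\<kappa> * \<bar>\<integral>x. f x \<partial>lebesgue_on Q\<bar> \<le> sobolev_dual_norm U \<alpha> p' L"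
    using abs_le_sobolev_dual_norm[OF _ g norm_g, of L] L \<open>0 < \<kappa>\<close> by (simp add: represents_def abs_mult)
  then have "\<bar>\<integral>x. f x \<partial>lebesgue_on Q\<bar> \<le> neg_sobolev_norm U \<alpha> p f / \<kappa>"
    using \<open>0 < \<kappa>\<close> by (simp add: neg_sobolev_norm_def L_def p'_def field_simps)
  then have "\<bar>average Q f\<bar> \<le> neg_sobolev_norm U \<alpha> p f / \<kappa> / (2 * h) ^ CARD('n)"
    unfolding average_def Q_def measure_lebesgue_cube[OF \<open>0 < h\<close>]
    using \<open>0 < h\<close> divide_right_mono[of _ _ "(2 * h) ^ CARD('n)"] by (simp only: abs_divide) fastforce
  also have "\<dots> = 1 / \<kappa> * (2 * h) powr (- ?n) * neg_sobolev_norm U \<alpha> p f"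
    using assms by (simp add: powr_minus_divide powr_realpow)
  also have "1 / \<kappa> = indicator_const CARD('n) (\<alpha> * p') powr (1 / p') * (2 * h) powr ((?n - \<alpha> * p') / p')"
  proof -
    have "1 / \<kappa> = X powr (1 / p')"
      unfolding \<kappa>_def minus_divide_left[symmetric] powr_minus_divide by simp
    then show ?thesis
      unfolding X_def using \<open>0 < h\<close> indicator_const_pos[OF \<gamma>, of "CARD('n)"]
      by (simp only: powr_mult powr_powr times_divide_eq_right mult_1_right)
  qed
  also have "(?n - \<alpha> * p') / p' = ?n - (\<alpha> + ?n / p)"
    using p' assms by (simp add: p'_def field_simps)
  finally show ?thesis
    by (simp add: mult.assoc flip: powr_add)
qed

lemma quadratic_form_sum: "e \<bullet> (b *v e) = (\<Sum>i\<in>UNIV. \<Sum>j\<in>UNIV. e $ i * e $ j * b $ i $ j)"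
  for e :: "real^'n"
  by (simp add: inner_vec_def matrix_vector_mult_def sum_distrib_left mult_ac)

text \<open>Cauchy-Schwarz over index pairs: the coefficients \<open>e $ i * e $ j\<close> have
  Euclidean norm \<open>(norm e)\<^sup>2\<close>, which matches the Euclidean combination in
  \<open>neg_sobolev_norm_mat\<close> and costs no dimensional factor.\<close>

lemma neg_sobolev_mat_average_cube_le:
  fixes z e :: "real^'n" and \<alpha> p h :: real and b :: "real^'n \<Rightarrow> real^'n^'n"
  assumes b: "in_neg_sobolev_mat U \<alpha> p b" and U: "U \<in> sets lebesgue"
    and "1 < p" "0 \<le> \<alpha>" "\<alpha> < 1 - 1 / p" "0 < h" "2 * h \<le> 1"
  defines "Q \<equiv> box (z - vec h) (z + vec h)" and "p' \<equiv> p / (p - 1)"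
  assumes "Q \<subseteq> U"
  shows "average Q (\<lambda>x. e \<bullet> (b x *v e)) \<le> indicator_const CARD('n) (\<alpha> * p') powr (1 / p')
    * (2 * h) powr (- (\<alpha> + real CARD('n) / p)) * neg_sobolev_norm_mat U \<alpha> p b * (norm e)\<^sup>2"
proof -
  define R where "R = indicator_const CARD('n) (\<alpha> * p') powr (1 / p') * (2 * h) powr (- (\<alpha> + real CARD('n) / p))"
  define N where "N i j = neg_sobolev_norm U \<alpha> p (\<lambda>x. b x $ i $ j)" for i j
  have bij: "in_neg_sobolev U \<alpha> p (\<lambda>x. b x $ i $ j)" for i j
    using b by (simp add: in_neg_sobolev_mat_def)
  have int: "integrable (lebesgue_on Q) (\<lambda>x. b x $ i $ j)" for i j
  proof -
    have "integrable (lebesgue_on U) (\<lambda>x. b x $ i $ j)"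
      using bij by (simp add: in_neg_sobolev_def)
    moreover have "Q \<in> sets lebesgue"
      by (simp add: Q_def)
    ultimately show ?thesis
      using U \<open>Q \<subseteq> U\<close> set_integrable_subset[of lebesgue U "\<lambda>x. b x $ i $ j" Q]
      by (simp add: integrable_restrict_space set_integrable_def)
  qed
  have "average Q (\<lambda>x. e \<bullet> (b x *v e)) = (\<Sum>i\<in>UNIV. \<Sum>j\<in>UNIV. e $ i * e $ j * average Q (\<lambda>x. b x $ i $ j))"
    unfolding average_def quadratic_form_sum
    by (simp add: Bochner_Integration.integral_sum int sum_divide_distrib)
  also have "\<dots> \<le> (\<Sum>i\<in>UNIV. \<Sum>j\<in>UNIV. \<bar>e $ i\<bar> * \<bar>e $ j\<bar> * (R * N i j))"
  proof (intro sum_mono)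
    fix i j
    have "\<bar>average Q (\<lambda>x. b x $ i $ j)\<bar> \<le> R * N i j"
      unfolding R_def N_def Q_def p'_def
      using neg_sobolev_average_cube_le[OF bij U] assms by simp
    then have "\<bar>e $ i * e $ j * average Q (\<lambda>x. b x $ i $ j)\<bar> \<le> \<bar>e $ i\<bar> * \<bar>e $ j\<bar> * (R * N i j)"
      by (simp add: abs_mult mult_left_mono)
    then show "e $ i * e $ j * average Q (\<lambda>x. b x $ i $ j) \<le> \<bar>e $ i\<bar> * \<bar>e $ j\<bar> * (R * N i j)"
      by linarith
  qed
  also have "\<dots> = R * (\<Sum>(i, j)\<in>UNIV. (\<bar>e $ i\<bar> * \<bar>e $ j\<bar>) * N i j)"
    by (simp add: sum.cartesian_product sum_distrib_left mult_ac split_def flip: UNIV_Times_UNIV)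
  also have "\<dots> \<le> R * (sqrt (\<Sum>(i, j)\<in>UNIV. (\<bar>e $ i\<bar> * \<bar>e $ j\<bar>)\<^sup>2) * sqrt (\<Sum>(i, j)\<in>UNIV. (N i j)\<^sup>2))"
  proof (rule mult_left_mono)
    have "(\<Sum>(i, j)\<in>UNIV. (\<bar>e $ i\<bar> * \<bar>e $ j\<bar>) * N i j)\<^sup>2
        \<le> (\<Sum>(i, j)\<in>UNIV. (\<bar>e $ i\<bar> * \<bar>e $ j\<bar>)\<^sup>2) * (\<Sum>(i, j)\<in>UNIV. (N i j)\<^sup>2)"
      unfolding split_def by (rule Cauchy_Schwarz_ineq_sum)
    then show "(\<Sum>(i, j)\<in>UNIV. (\<bar>e $ i\<bar> * \<bar>e $ j\<bar>) * N i j)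
        \<le> sqrt (\<Sum>(i, j)\<in>UNIV. (\<bar>e $ i\<bar> * \<bar>e $ j\<bar>)\<^sup>2) * sqrt (\<Sum>(i, j)\<in>UNIV. (N i j)\<^sup>2)"
      unfolding real_sqrt_mult[symmetric] by (rule real_le_rsqrt)
  qed (simp add: R_def)
  also have "(\<Sum>(i, j)\<in>UNIV. (\<bar>e $ i\<bar> * \<bar>e $ j\<bar>)\<^sup>2) = (\<Sum>i\<in>UNIV. \<Sum>j\<in>UNIV. (e $ i)\<^sup>2 * (e $ j)\<^sup>2)"
    by (simp add: sum.cartesian_product power_mult_distrib flip: UNIV_Times_UNIV)
  also have "\<dots> = ((norm e)\<^sup>2)\<^sup>2"
    unfolding sum_product[symmetric] power2_norm_eq_inner by (simp add: inner_vec_def power2_eq_square)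
  also have "sqrt (((norm e)\<^sup>2)\<^sup>2) = (norm e)\<^sup>2"
    by (simp only: real_sqrt_abs abs_power2)
  also have "sqrt (\<Sum>(i, j)\<in>UNIV. (N i j)\<^sup>2) = neg_sobolev_norm_mat U \<alpha> p b"
    by (simp add: neg_sobolev_norm_mat_def N_def sum.cartesian_product flip: UNIV_Times_UNIV)
  finally show ?thesis
    by (simp add: R_def mult_ac)
qed

section \<open>Quadratic forms as suprema\<close>

text \<open>Cauchy's functional equation under a local bound. The defect
  \<open>h t = g t - t * g 1\<close> is additive and vanishes on the integers, so it has period 1
  and is bounded everywhere; since \<open>h (real n * t) = real n * h t\<close>, it must be
  0.\<close>

lemma additive_bounded_imp_scaleR:
  fixes g :: "real \<Rightarrow> real"
  assumes add: "\<And>s t. g (s + t) = g s + g t"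
    and bound: "\<And>t. 0 \<le> t \<Longrightarrow> t \<le> 1 \<Longrightarrow> \<bar>g t\<bar> \<le> M"
  shows "g t = t * g 1"
proof -
  define h where "h t = g t - t * g 1" for t
  have h_add: "h (s + t) = h s + h t" for s t
    using add[of s t] distrib_right[of s t "g 1"] unfolding h_def by linarith
  have h_nat: "h (real n * t) = real n * h t" for n t
  proof (induction n)
    case 0
    show ?case
      using h_add[of 0 0] by simp
  next
    case (Suc n)
    have "h (real (Suc n) * t) = h (real n * t) + h t"
      using h_add[of "real n * t" t] by (simp add: algebra_simps)
    with Suc show ?case
      by (simp add: algebra_simps)
  qed
  have h_of_nat: "h (real n) = 0" for n
    using h_nat[of n 1] by (simp add: h_def)
  have h_int: "h (of_int k) = 0" for k
  proof (cases k rule: int_cases2)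
    case (nonneg n)
    then show ?thesis
      using h_of_nat[of n] by simp
  next
    case (nonpos n)
    then show ?thesis
      using h_add[of "real n" "- real n"] h_of_nat[of n] h_of_nat[of 0] by simp
  qed
  have h_bound: "\<bar>h t\<bar> \<le> M + \<bar>g 1\<bar>" for t
  proof -
    have "h t = h (frac t)"
      using h_add[of "frac t" "of_int \<lfloor>t\<rfloor>"] h_int by (simp add: frac_def)
    also have "\<bar>\<dots>\<bar> \<le> \<bar>g (frac t)\<bar> + \<bar>frac t * g 1\<bar>"
      unfolding h_def by (rule abs_triangle_ineq4)
    also have "\<dots> \<le> M + \<bar>g 1\<bar>"
    proof (rule add_mono)
      show "\<bar>g (frac t)\<bar> \<le> M"
        using frac_lt_1[of t] by (intro bound) auto
      show "\<bar>frac t * g 1\<bar> \<le> \<bar>g 1\<bar>"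
        using frac_lt_1[of t] by (simp add: abs_mult mult_left_le_one_le)
    qed
    finally show ?thesis .
  qed
  have "h t = 0"
  proof (rule ccontr)
    assume "h t \<noteq> 0"
    then obtain n where "M + \<bar>g 1\<bar> < real n * \<bar>h t\<bar>"
      using reals_Archimedean3[of "\<bar>h t\<bar>"] by auto
    then show False
      using h_bound[of "real n * t"] h_nat[of n t] by (simp add: abs_mult)
  qed
  then show ?thesis
    by (simp add: h_def)
qed

text \<open>Polarisation defines a symmetric \<open>b\<close>. The parallelogram law makes it
  additive, and \<open>bound\<close> supplies the real homogeneity that additivity alone does not
  give.\<close>

lemma jordan_von_neumann:
  fixes N :: "real^'n \<Rightarrow> real"
  assumes par: "\<And>x y. N (x + y) + N (x - y) = 2 * N x + 2 * N y"
    and hom: "\<And>c x. N (c *\<^sub>R x) = c\<^sup>2 * N x"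
    and bound: "\<And>x. \<bar>N x\<bar> \<le> K * (norm x)\<^sup>2"
  obtains M :: "real^'n^'n" where "transpose M = M" "\<And>e. e \<bullet> (M *v e) = N e"
proof -
  define b where "b x y = (N (x + y) - N (x - y)) / 4" for x y
  have sym: "b x y = b y x" for x y
    using hom[of "-1" "x - y"] by (simp add: b_def add.commute[of x y])
  have N0: "N 0 = 0"
    using hom[of 0 0] by simp
  have b0: "b 0 z = 0" for z
    using hom[of "-1" z] by (simp add: b_def)
  have b_mid: "b x z + b y z = b (x + y) (2 *\<^sub>R z) / 2" for x y z
  proof -
    have "2 * N (x + z) + 2 * N (y + z) = N (x + y + 2 *\<^sub>R z) + N (x - y)"
      using par[of "x + z" "y + z"] by (simp add: scaleR_2 algebra_simps)
    moreover have "2 * N (x - z) + 2 * N (y - z) = N (x + y - 2 *\<^sub>R z) + N (x - y)"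
      using par[of "x - z" "y - z"] by (simp add: scaleR_2 algebra_simps)
    ultimately show ?thesis
      by (simp add: b_def field_simps)
  qed
  \<comment> \<open>Both instances of \<open>b_mid\<close> have the same right-hand side, and in the
    first one the summand at 0 vanishes.\<close>
  have b_add: "b (x + y) z = b x z + b y z" for x y z
    using b_mid[of "x + y" z 0] b_mid[of x z y] b0 by simp
  have b_scale: "b (t *\<^sub>R x) z = t * b x z" for t x z
  proof -
    have "b (t *\<^sub>R x) z = t * b (1 *\<^sub>R x) z"
    proof (rule additive_bounded_imp_scaleR)
      fix s t show "b ((s + t) *\<^sub>R x) z = b (s *\<^sub>R x) z + b (t *\<^sub>R x) z"
        by (simp add: scaleR_add_left b_add)
    next
      fix t :: real assume t: "0 \<le> t" "t \<le> 1"
      have tx: "norm (t *\<^sub>R x) \<le> norm x"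
        using t by (simp add: mult_left_le_one_le)
      have "0 \<le> K"
      proof -
        have "0 \<le> K * (norm (axis undefined 1 :: real^'n))\<^sup>2"
          using bound abs_ge_zero order_trans by blast
        then show ?thesis
          by simp
      qed
      then have "\<bar>N (t *\<^sub>R x + z)\<bar> \<le> K * (norm x + norm z)\<^sup>2" "\<bar>N (t *\<^sub>R x - z)\<bar> \<le> K * (norm x + norm z)\<^sup>2"
        using tx norm_triangle_ineq[of "t *\<^sub>R x" z] norm_triangle_ineq4[of "t *\<^sub>R x" z]
        by (intro order_trans[OF bound] mult_left_mono power_mono; simp)+
      then show "\<bar>b (t *\<^sub>R x) z\<bar> \<le> K * (norm x + norm z)\<^sup>2"
        by (simp add: b_def)
    qed
    then show ?thesis
      by simp
  qed
  have lin: "linear (\<lambda>x. b x z)" for z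
    by (intro linearI) (simp_all add: b_add b_scale)
  define M :: "real^'n^'n" where "M = (\<chi> i j. b (axis j 1) (axis i 1))"
  have form: "e \<bullet> (M *v e) = N e" for e
  proof -
    have expand: "b e z = (\<Sum>i\<in>UNIV. b (axis i 1) z * e $ i)" for z
    proof -
      have "b e z = b (\<Sum>i\<in>UNIV. (e $ i) *\<^sub>R axis i 1) z"
        using basis_expansion[of e] by (simp add: scalar_mult_eq_scaleR)
      then show ?thesis
        by (simp add: linear_sum[OF lin] b_scale mult.commute)
    qed
    have "e \<bullet> (M *v e) = (\<Sum>i\<in>UNIV. e $ i * (\<Sum>j\<in>UNIV. b (axis j 1) (axis i 1) * e $ j))"
      by (simp add: M_def inner_vec_def matrix_vector_mult_def)
    also have "\<dots> = (\<Sum>i\<in>UNIV. e $ i * b e (axis i 1))"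
      by (simp only: expand[symmetric])
    also have "\<dots> = (\<Sum>i\<in>UNIV. b (axis i 1) e * e $ i)"
    proof (rule sum.cong)
      fix i
      show "e $ i * b e (axis i 1) = b (axis i 1) e * e $ i"
        using sym[of e "axis i 1"] by simp
    qed simp
    also have "\<dots> = b e e"
      by (rule expand[symmetric])
    also have "\<dots> = N e"
      using hom[of 2 e] N0 by (simp add: b_def scaleR_2)
    finally show ?thesis .
  qed
  have "M $ i $ j = M $ j $ i" for i j
    unfolding M_def vec_lambda_beta by (rule sym)
  then have "transpose M = M"
    by (simp add: transpose_def vec_eq_iff)
  then show ?thesis
    using form by (rule that)
qed

lemma symmetric_form_commute:
  fixes A :: "real^'n^'n"
  assumes "transpose A = A"
  shows "x \<bullet> (A *v y) = y \<bullet> (A *v x)"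
proof -
  have "x \<bullet> (A *v y) = (x v* A) \<bullet> y"
    by (rule dot_lmul_matrix[symmetric])
  also have "x v* A = A *v x"
    by (simp only: assms flip: transpose_matrix_vector)
  finally show ?thesis
    by (simp add: inner_commute)
qed

text \<open>Polarisation; this gives the uniqueness that the description in \<open>astar_inv\<close>
  demands.\<close>

lemma symmetric_matrix_eqI:
  fixes A B :: "real^'n^'n"
  assumes "transpose A = A" "transpose B = B" "\<And>e. e \<bullet> (A *v e) = e \<bullet> (B *v e)"
  shows "A = B"
proof -
  have comm: "x \<bullet> (C *v y) = y \<bullet> (C *v x)" if "transpose C = C" for C :: "real^'n^'n" and x y
    using that by (rule symmetric_form_commute)
  have pol: "2 * (x \<bullet> (C *v y)) = (x + y) \<bullet> (C *v (x + y)) - x \<bullet> (C *v x) - y \<bullet> (C *v y)"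
    if "transpose C = C" for C :: "real^'n^'n" and x y
    using comm[OF that, of x y] by (simp add: matrix_vector_right_distrib inner_add_left inner_add_right)
  have "x \<bullet> (A *v y) = x \<bullet> (B *v y)" for x y
    using pol[OF assms(1), of x y] pol[OF assms(2), of x y] assms(3) by simp
  then have "A *v y = B *v y" for y
    using vector_eq_ldot[of "A *v y" "B *v y"] by blast
  then show ?thesis
    by (simp add: matrix_eq)
qed

text \<open>Polarisation on unit vectors takes the place of a spectral decomposition: the form at
  \<open>x - y\<close> is dropped by nonnegativity, and the form at \<open>x + y\<close> is at most
  4K. Pairing with the direction of \<open>A *v y\<close> then gives the operator norm.\<close>

lemma onorm_symmetric_matrix_le:
  fixes A :: "real^'n^'n"
  assumes "transpose A = A" "\<And>e. 0 \<le> e \<bullet> (A *v e)" "\<And>e. e \<bullet> (A *v e) \<le> K * (norm e)\<^sup>2"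
  shows "onorm ((*v) A) \<le> K"
proof (rule onorm_le)
  fix y :: "real^'n"
  have comm: "x \<bullet> (A *v y) = y \<bullet> (A *v x)" for x y
    using assms(1) by (rule symmetric_form_commute)
  have unit: "x \<bullet> (A *v y) \<le> K" if "norm x = 1" "norm y = 1" for x y
  proof -
    have "4 * (x \<bullet> (A *v y)) = (x + y) \<bullet> (A *v (x + y)) - (x - y) \<bullet> (A *v (x - y))"
      using comm[of x y]
      by (simp add: matrix_vector_right_distrib matrix_vector_mult_diff_distrib inner_add_left
          inner_add_right inner_diff_left inner_diff_right)
    also have "\<dots> \<le> K * (norm (x + y))\<^sup>2"
      using assms(2)[of "x - y"] assms(3)[of "x + y"] by linarith
    also have "\<dots> \<le> K * 2\<^sup>2"
    proof (intro mult_left_mono power_mono)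
      show "norm (x + y) \<le> 2"
        using norm_triangle_ineq[of x y] that by simp
      show "0 \<le> K"
        using assms(2)[of x] assms(3)[of x] that by simp
    qed simp
    finally show ?thesis
      by simp
  qed
  show "norm (A *v y) \<le> K * norm y"
  proof (cases "A *v y = 0 \<or> y = 0")
    case True
    moreover have "0 \<le> K"
    proof -
      have "0 \<le> K * (norm (axis undefined 1 :: real^'n))\<^sup>2"
        using assms(2,3) order_trans by blast
      then show ?thesis
        by simp
    qed
    ultimately show ?thesis
      by (auto simp: zero_le_mult_iff)
  next
    case False
    let ?w = "A *v y"
    have "(?w /\<^sub>R norm ?w) \<bullet> (A *v (y /\<^sub>R norm y)) \<le> K"
      using False by (intro unit) auto
    moreover have "(?w /\<^sub>R norm ?w) \<bullet> (A *v (y /\<^sub>R norm y)) = norm ?w / norm y"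
      using False by (simp add: matrix_vector_mult_scaleR power2_norm_eq_inner[symmetric] power2_eq_square field_simps)
    ultimately show ?thesis
      using False by (simp add: field_simps)
  qed
qed

text \<open>Testing with the sum and difference of two competitors gives one half of the parallelogram law;
  the other half is the same inequality at \<open>e + f\<close> and \<open>e - f\<close>.\<close>

lemma quadratic_supremum_is_form:
  fixes B :: "'p \<Rightarrow> real" and l :: "real^'n \<Rightarrow> 'p \<Rightarrow> real"
  defines "J \<equiv> \<lambda>e p. 2 * l e p - B p"
  assumes P: "P \<noteq> {}"
    and lin: "\<And>p. p \<in> P \<Longrightarrow> linear (\<lambda>e. l e p)"
    and sum: "\<And>p q. p \<in> P \<Longrightarrow> q \<in> P \<Longrightarrow> \<exists>r\<in>P. \<exists>s\<in>P. B r + B s = 2 * B p + 2 * B q \<and>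
      (\<forall>e. l e r = l e p + l e q) \<and> (\<forall>e. l e s = l e p - l e q)"
    and scale: "\<And>p c. p \<in> P \<Longrightarrow> \<exists>r\<in>P. B r = c\<^sup>2 * B p \<and> (\<forall>e. l e r = c * l e p)"
    and bound: "\<And>e p. p \<in> P \<Longrightarrow> J e p \<le> K * (norm e)\<^sup>2"
  obtains M :: "real^'n^'n" where "transpose M = M"
    "\<And>e. ereal (e \<bullet> (M *v e)) = (SUP p\<in>P. ereal (J e p))"
    "\<And>e. 0 \<le> e \<bullet> (M *v e)" "\<And>e. e \<bullet> (M *v e) \<le> K * (norm e)\<^sup>2"
proof -
  define N where "N e = (SUP p\<in>P. J e p)" for e
  have upper: "J e p \<le> N e" if "p \<in> P" for e p
    unfolding N_def using bound that by (intro cSUP_upper bdd_aboveI2) auto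
  have least: "N e \<le> x" if "\<And>p. p \<in> P \<Longrightarrow> J e p \<le> x" for e x
    unfolding N_def using P that by (intro cSUP_least) auto
  have l_add: "l (e + f) p = l e p + l f p" and l_diff: "l (e - f) p = l e p - l f p"
    and l_scale: "l (c *\<^sub>R e) p = c * l e p" if "p \<in> P" for e f c p
    using linear_add[OF lin[OF that]] linear_diff[OF lin[OF that]] linear_scale[OF lin[OF that]] by auto
  have nonneg: "0 \<le> N e" for e
  proof -
    obtain p where "p \<in> P"
      using P by blast
    \<comment> \<open>Scaling by 0 yields a competitor on which the functional vanishes.\<close>
    with scale[of p 0] obtain r where "r \<in> P" "B r = 0" "l e r = 0"
      by auto
    then show ?thesis
      using upper[of r e] by (simp add: J_def)
  qed
  have N_bound: "N e \<le> K * (norm e)\<^sup>2" for e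
    by (rule least) (rule bound)
  have hom_ge: "c\<^sup>2 * N e \<le> N (c *\<^sub>R e)" if "c \<noteq> 0" for c e
  proof -
    have "N e \<le> N (c *\<^sub>R e) / c\<^sup>2"
    proof (rule least)
      fix p assume p: "p \<in> P"
      with scale[of p c] obtain r where r: "r \<in> P" "B r = c\<^sup>2 * B p" "\<And>e. l e r = c * l e p"
        by blast
      have "J (c *\<^sub>R e) r = c\<^sup>2 * J e p"
        using r p by (simp add: J_def l_scale power2_eq_square algebra_simps)
      then show "J e p \<le> N (c *\<^sub>R e) / c\<^sup>2"
        using upper[OF r(1), of "c *\<^sub>R e"] that by (simp add: field_simps)
    qed
    then show ?thesis
      using that by (simp add: field_simps)
  qed
  have hom: "N (c *\<^sub>R e) = c\<^sup>2 * N e" for c e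
  proof (cases "c = 0")
    case True
    then show ?thesis
      using nonneg[of 0] N_bound[of 0] by simp
  next
    case False
    then show ?thesis
      using hom_ge[of c e] hom_ge[of "1 / c" "c *\<^sub>R e"] by (simp add: power_divide field_simps)
  qed
  have par_ge: "2 * N e + 2 * N f \<le> N (e + f) + N (e - f)" for e f
  proof -
    have *: "2 * J e p + 2 * J f q \<le> N (e + f) + N (e - f)" if p: "p \<in> P" and q: "q \<in> P" for p q
    proof -
      obtain r s where rs: "r \<in> P" "s \<in> P" "B r + B s = 2 * B p + 2 * B q"
        "\<And>e. l e r = l e p + l e q" "\<And>e. l e s = l e p - l e q"
        using sum[OF p q] by blast
      have "2 * J e p + 2 * J f q = J (e + f) r + J (e - f) s"
        using rs p q by (simp add: J_def l_add l_diff)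
      also have "\<dots> \<le> N (e + f) + N (e - f)"
        using rs by (intro add_mono upper)
      finally show ?thesis .
    qed
    have "N e \<le> (N (e + f) + N (e - f) - 2 * N f) / 2"
    proof (rule least)
      fix p assume p: "p \<in> P"
      have "N f \<le> (N (e + f) + N (e - f) - 2 * J e p) / 2"
        using *[OF p] by (intro least) (simp add: field_simps)
      then show "J e p \<le> (N (e + f) + N (e - f) - 2 * N f) / 2"
        by (simp add: field_simps)
    qed
    then show ?thesis
      by (simp add: field_simps)
  qed
  have par: "N (e + f) + N (e - f) = 2 * N e + 2 * N f" for e f
    using par_ge[of e f] par_ge[of "e + f" "e - f"] hom[of 2 e] hom[of 2 f]
    by (simp add: scaleR_2)
  have "\<bar>N e\<bar> \<le> K * (norm e)\<^sup>2" for e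
    using nonneg N_bound by simp
  from jordan_von_neumann[of N, OF par hom this]
  obtain M where M: "transpose M = M" "\<And>e. e \<bullet> (M *v e) = N e"
    by blast
  have "ereal (N e) = (SUP p\<in>P. ereal (J e p))" for e
    unfolding N_def
  proof (rule ereal_SUP)
    obtain p where "p \<in> P"
      using P by blast
    then have "ereal (J e p) \<le> (SUP p\<in>P. ereal (J e p))"
      by (rule SUP_upper)
    moreover have "(SUP p\<in>P. ereal (J e p)) \<le> ereal (N e)"
      using upper by (intro SUP_least) simp
    ultimately show "\<bar>SUP p\<in>P. ereal (J e p)\<bar> \<noteq> \<infinity>"
      by (cases "SUP p\<in>P. ereal (J e p)") auto
  qed
  with M nonneg N_bound that show ?thesis
    by simp
qed

section \<open>The weighted Sobolev space\<close>

lemma grad_linear_combination: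
  assumes "f differentiable (at x)" "g differentiable (at x)"
  shows "(\<lambda>x. c * f x + e * g x) differentiable (at x)"
    and "grad (\<lambda>x. c * f x + e * g x) x = c *\<^sub>R grad f x + e *\<^sub>R grad g x"
proof -
  have "((\<lambda>x. c * f x + e * g x) has_derivative
      (\<lambda>y. c * frechet_derivative f (at x) y + e * frechet_derivative g (at x) y)) (at x)"
    using assms unfolding frechet_derivative_works by (intro has_derivative_add has_derivative_mult_right)
  then show "(\<lambda>x. c * f x + e * g x) differentiable (at x)"
    and "grad (\<lambda>x. c * f x + e * g x) x = c *\<^sub>R grad f x + e *\<^sub>R grad g x"
    by (auto simp: differentiable_def grad_def vec_eq_iff simp flip: frechet_derivative_at)
qed

text \<open>Derivatives at a point of an open set depend only on nearby values. Needed because the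
  pointwise formula for the gradient of a combination is available only on \<open>U\<close>.\<close>

lemma Ck_on_cong:
  assumes "open U" "\<And>x. x \<in> U \<Longrightarrow> f x = g x" "Ck_on k U f"
  shows "Ck_on k U g"
  using assms(2,3)
proof (induction k arbitrary: f g)
  case 0
  then show ?case
    using continuous_on_cong[of U U f g] by simp
next
  case (Suc k)
  have diff: "f differentiable (at x)" if "x \<in> U" for x
    using Suc.prems that by simp
  have "g differentiable (at x)" if "x \<in> U" for x
    using diff[OF that] has_derivative_transform_within_open[of f _ x UNIV U g] assms(1) that Suc.prems(1)
    unfolding differentiable_def by blast
  moreover have "Ck_on k U (\<lambda>x. grad g x $ i)" for i
  proof (rule Suc.IH)
    show "Ck_on k U (\<lambda>x. grad f x $ i)"
      using Suc.prems by simp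
    show "grad f x $ i = grad g x $ i" if "x \<in> U" for x
      using frechet_derivative_transform_within_open[OF diff[OF that] assms(1) that Suc.prems(1)]
      by (simp add: grad_def)
  qed
  ultimately show ?case
    by simp
qed

lemma Ck_on_linear_combination:
  assumes "open U" "Ck_on k U f" "Ck_on k U g"
  shows "Ck_on k U (\<lambda>x. c * f x + e * g x)"
  using assms(2,3)
proof (induction k arbitrary: f g)
  case 0
  then show ?case
    by (auto intro!: continuous_intros)
next
  case (Suc k)
  have "Ck_on k U (\<lambda>x. grad (\<lambda>x. c * f x + e * g x) x $ i)" for i
  proof (rule Ck_on_cong[OF assms(1)])
    show "Ck_on k U (\<lambda>x. c * grad f x $ i + e * grad g x $ i)"
      using Suc by simp
  qed (use Suc.prems in \<open>simp add: grad_linear_combination\<close>)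
  then show ?case
    using Suc.prems by (simp add: grad_linear_combination)
qed

lemma smooth_on_linear_combination:
  "open U \<Longrightarrow> smooth_on U f \<Longrightarrow> smooth_on U g \<Longrightarrow> smooth_on U (\<lambda>x. c * f x + e * g x)"
  by (simp add: smooth_on_def Ck_on_linear_combination)

lemma Ck_on_zero: "Ck_on k U (\<lambda>x. 0)"
  for U :: "(real^'n) set"
proof (induction k)
  case (Suc k)
  have "grad (\<lambda>x::real^'n. 0) = (\<lambda>x. 0)"
    by (simp add: grad_def fun_eq_iff vec_eq_iff)
  with Suc show ?case
    by simp
qed simp

lemma smooth_on_continuous:
  assumes "smooth_on U f"
  shows "continuous_on U f" "continuous_on U (grad f)"
proof -
  have "Ck_on 0 U f" "Ck_on (Suc 0) U f"
    using assms unfolding smooth_on_def by blast+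
  moreover have "continuous_on U (\<lambda>x. \<chi> i. grad f x $ i)"
    by (rule continuous_on_vec_lambda) (use calculation in simp)
  ultimately show "continuous_on U f" "continuous_on U (grad f)"
    by simp_all
qed

lemma smooth_on_measurable:
  assumes "smooth_on U f" "U \<in> sets lebesgue"
  shows "f \<in> borel_measurable (lebesgue_on U)" "grad f \<in> borel_measurable (lebesgue_on U)"
  using smooth_on_continuous[OF assms(1)] assms(2) by (auto intro: continuous_imp_measurable_on_sets_lebesgue)

section \<open>Measurability and pointwise inequalities for matrix forms\<close>

lemma borel_measurable_form:
  fixes a :: "'a \<Rightarrow> real^'n^'n"
  assumes [measurable]: "a \<in> borel_measurable M" "v \<in> borel_measurable M" "w \<in> borel_measurable M"
  shows "(\<lambda>x. v x \<bullet> (a x *v w x)) \<in> borel_measurable M"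
proof -
  have "(\<lambda>A::real^'n^'n. A $ i $ j) \<in> borel_measurable borel" for i j
    by (intro borel_measurable_continuous_onI continuous_intros)
  then have [measurable]: "(\<lambda>x. a x $ i $ j) \<in> borel_measurable M" for i j
    using measurable_compose[OF assms(1)] by blast
  have [measurable]: "(\<lambda>x. v x $ i) \<in> borel_measurable M" "(\<lambda>x. w x $ i) \<in> borel_measurable M" for i
    using measurable_compose[OF assms(2) borel_measurable_nth] measurable_compose[OF assms(3) borel_measurable_nth]
    by auto
  show ?thesis
    unfolding inner_vec_def matrix_vector_mult_def by simp
qed

definition psd :: "real^'n^'n \<Rightarrow> bool"
  where "psd A \<longleftrightarrow> transpose A = A \<and> (\<forall>\<xi>. 0 \<le> \<xi> \<bullet> (A *v \<xi>))"

lemma psd_nonneg: "psd A \<Longrightarrow> 0 \<le> x \<bullet> (A *v x)"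
  by (simp add: psd_def)

lemma psd_commute: "psd A \<Longrightarrow> x \<bullet> (A *v y) = y \<bullet> (A *v x)"
  by (simp add: psd_def symmetric_form_commute)

lemma form_parallelogram:
  "(x + y) \<bullet> (A *v (x + y)) + (x - y) \<bullet> (A *v (x - y)) = 2 * (x \<bullet> (A *v x)) + 2 * (y \<bullet> (A *v y))"
  for x y :: "real^'n"
  by (simp add: matrix_vector_right_distrib matrix_vector_mult_diff_distrib inner_add_left
      inner_add_right inner_diff_left inner_diff_right)

lemma form_scaleR: "(c *\<^sub>R x) \<bullet> (A *v (c *\<^sub>R x)) = c\<^sup>2 * (x \<bullet> (A *v x))"
  for x :: "real^'n"
  by (simp add: matrix_vector_mult_scaleR power2_eq_square)

text \<open>The parallelogram law with the form of the difference dropped.\<close>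

lemma psd_add_le:
  assumes "psd A"
  shows "(c *\<^sub>R x + e *\<^sub>R y) \<bullet> (A *v (c *\<^sub>R x + e *\<^sub>R y)) \<le> 2 * c\<^sup>2 * (x \<bullet> (A *v x)) + 2 * e\<^sup>2 * (y \<bullet> (A *v y))"
  using form_parallelogram[of "c *\<^sub>R x" "e *\<^sub>R y" A] psd_nonneg[OF assms, of "c *\<^sub>R x - e *\<^sub>R y"]
  unfolding form_scaleR by linarith

text \<open>Nonnegativity of the form at \<open>x + y\<close> and at \<open>x - y\<close> gives even
  half of this bound. It provides an integrable majorant for mixed terms.\<close>

lemma psd_abs_form_le:
  assumes "psd A"
  shows "\<bar>x \<bullet> (A *v y)\<bar> \<le> x \<bullet> (A *v x) + y \<bullet> (A *v y)"
  using psd_nonneg[OF assms, of "x + y"] psd_nonneg[OF assms, of "x - y"] psd_commute[OF assms, of x y]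
    psd_nonneg[OF assms, of x] psd_nonneg[OF assms, of y]
  by (simp add: matrix_vector_right_distrib matrix_vector_mult_diff_distrib inner_add_left
      inner_add_right inner_diff_left inner_diff_right)

lemma matrix_inv_right:
  fixes A :: "real^'n^'n"
  assumes "invertible A"
  shows "A ** matrix_inv A = mat 1"
  using assms someI_ex[of "\<lambda>A'. A ** A' = mat 1 \<and> A' ** A = mat 1"]
  by (simp add: invertible_def matrix_inv_def)

text \<open>The square is completed about \<open>matrix_inv A *v e\<close>, the maximiser of the
  left-hand side in \<open>v\<close>.\<close>

lemma psd_legendre:
  assumes "psd A" "invertible A"
  shows "2 * (e \<bullet> v) - v \<bullet> (A *v v) \<le> e \<bullet> (matrix_inv A *v e)"
proof -
  define w where "w = matrix_inv A *v e"
  have w: "A *v w = e"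
    using assms(2) by (simp add: w_def matrix_vector_mul_assoc matrix_inv_right)
  have "0 \<le> (v - w) \<bullet> (A *v (v - w))"
    by (rule psd_nonneg[OF assms(1)])
  also have "\<dots> = v \<bullet> (A *v v) - 2 * (e \<bullet> v) + e \<bullet> w"
    using psd_commute[OF assms(1), of v w] w
    by (simp add: matrix_vector_mult_diff_distrib inner_diff_left inner_diff_right inner_commute)
  finally show ?thesis
    by (simp add: w_def)
qed

lemma psd_inverse_nonneg:
  assumes "psd A" "invertible A"
  shows "0 \<le> e \<bullet> (matrix_inv A *v e)"
  using psd_legendre[OF assms, of e 0] by simp

lemma coefficient_field_psd: "coefficient_field U a \<Longrightarrow> x \<in> U \<Longrightarrow> psd (a x)"
  by (simp add: coefficient_field_def psd_def)

section \<open>Coefficient fields on subdomains, and the linear structure of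
  \<open>H1\<close>\<close>

lemma integrable_lebesgue_on_subset:
  fixes f :: "'a::euclidean_space \<Rightarrow> 'b::euclidean_space"
  assumes "integrable (lebesgue_on U) f" "V \<subseteq> U" "V \<in> sets lebesgue" "U \<in> sets lebesgue"
  shows "integrable (lebesgue_on V) f"
  using assms set_integrable_subset[of lebesgue U f V]
  by (simp add: integrable_restrict_space set_integrable_def)

lemma coefficient_field_subset:
  assumes "coefficient_field U a" "V \<subseteq> U" "V \<in> sets lebesgue" "U \<in> sets lebesgue"
  shows "coefficient_field V a"
proof -
  have "AE x in lebesgue_on V. invertible (a x)"
  proof -
    have "AE x in lebesgue. x \<in> U \<longrightarrow> invertible (a x)"
      using assms(1,4) by (simp add: coefficient_field_def AE_restrict_space_iff)
    then have "AE x in lebesgue. x \<in> V \<longrightarrow> invertible (a x)"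
      using assms(2) by (auto elim!: eventually_mono)
    then show ?thesis
      using assms(3) by (simp add: AE_restrict_space_iff)
  qed
  then show ?thesis
    using assms(1,2) unfolding coefficient_field_def
    by (auto intro: integrable_lebesgue_on_subset[OF _ assms(2-4)])
qed

lemma integrable_matrix_form:
  fixes a :: "'a \<Rightarrow> real^'n^'n"
  assumes "integrable M a"
  shows "integrable M (\<lambda>x. e \<bullet> (a x *v f))"
proof -
  have "bounded_linear (\<lambda>A::real^'n^'n. e \<bullet> (A *v f))"
    by (intro linear_linear[THEN iffD2] linearI)
       (auto simp: matrix_vector_mult_add_rdistrib inner_add_right scaleR_matrix_vector_assoc[symmetric])
  from integrable_bounded_linear[OF this assms] show ?thesis .
qed

text \<open>A triangle inequality for the squared norm, at the price of a factor 2 and valid for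
  infinite values; it suffices for both the limits and the finiteness claims below.\<close>

lemma H1_norm_sq_linear_combination_le:
  assumes "coefficient_field U a" "U \<in> sets lebesgue"
    and [measurable]: "u \<in> borel_measurable (lebesgue_on U)" "w \<in> borel_measurable (lebesgue_on U)"
      "v \<in> borel_measurable (lebesgue_on U)" "z \<in> borel_measurable (lebesgue_on U)"
  shows "H1_norm_sq U a (\<lambda>x. c * u x + e * w x) (\<lambda>x. c *\<^sub>R v x + e *\<^sub>R z x)
    \<le> ennreal (2 * c\<^sup>2) * H1_norm_sq U a u v + ennreal (2 * e\<^sup>2) * H1_norm_sq U a w z"
proof -
  let ?M = "lebesgue_on U"
  have a: "a \<in> borel_measurable ?M"
    using assms(1) by (simp add: coefficient_field_def borel_measurable_integrable)
  note [measurable] = borel_measurable_form[OF a]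
  have psd: "x \<in> U \<Longrightarrow> psd (a x)" for x
    using assms(1) by (rule coefficient_field_psd)
  have "(\<integral>\<^sup>+x. ennreal ((c * u x + e * w x)\<^sup>2) \<partial>?M)
      \<le> (\<integral>\<^sup>+x. ennreal (2 * c\<^sup>2) * ennreal ((u x)\<^sup>2) + ennreal (2 * e\<^sup>2) * ennreal ((w x)\<^sup>2) \<partial>?M)"
  proof (intro nn_integral_mono)
    fix x
    have "(c * u x + e * w x)\<^sup>2 \<le> 2 * c\<^sup>2 * (u x)\<^sup>2 + 2 * e\<^sup>2 * (w x)\<^sup>2"
      using sum_squares_ge_zero[of "c * u x - e * w x" 0] by (simp add: power2_eq_square algebra_simps)
    then show "ennreal ((c * u x + e * w x)\<^sup>2) \<le> ennreal (2 * c\<^sup>2) * ennreal ((u x)\<^sup>2) + ennreal (2 * e\<^sup>2) * ennreal ((w x)\<^sup>2)"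
      by (simp add: ennreal_leI flip: ennreal_mult ennreal_plus)
  qed
  moreover have "(\<integral>\<^sup>+x. ennreal ((c *\<^sub>R v x + e *\<^sub>R z x) \<bullet> (a x *v (c *\<^sub>R v x + e *\<^sub>R z x))) \<partial>?M)
      \<le> (\<integral>\<^sup>+x. ennreal (2 * c\<^sup>2) * ennreal (v x \<bullet> (a x *v v x)) + ennreal (2 * e\<^sup>2) * ennreal (z x \<bullet> (a x *v z x)) \<partial>?M)"
  proof (intro nn_integral_mono)
    fix x assume "x \<in> space ?M"
    then have "psd (a x)"
      using psd by simp
    from psd_add_le[OF this, of c "v x" e "z x"] psd_nonneg[OF this]
    show "ennreal ((c *\<^sub>R v x + e *\<^sub>R z x) \<bullet> (a x *v (c *\<^sub>R v x + e *\<^sub>R z x)))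
        \<le> ennreal (2 * c\<^sup>2) * ennreal (v x \<bullet> (a x *v v x)) + ennreal (2 * e\<^sup>2) * ennreal (z x \<bullet> (a x *v z x))"
      by (simp add: ennreal_leI flip: ennreal_mult ennreal_plus)
  qed
  ultimately have "H1_norm_sq U a (\<lambda>x. c * u x + e * w x) (\<lambda>x. c *\<^sub>R v x + e *\<^sub>R z x)
    \<le> (\<integral>\<^sup>+x. ennreal (2 * c\<^sup>2) * ennreal ((u x)\<^sup>2) + ennreal (2 * e\<^sup>2) * ennreal ((w x)\<^sup>2) \<partial>?M)
      + (\<integral>\<^sup>+x. ennreal (2 * c\<^sup>2) * ennreal (v x \<bullet> (a x *v v x)) + ennreal (2 * e\<^sup>2) * ennreal (z x \<bullet> (a x *v z x)) \<partial>?M)"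
    unfolding H1_norm_sq_def by (rule add_mono)
  also have "\<dots> = ennreal (2 * c\<^sup>2) * H1_norm_sq U a u v + ennreal (2 * e\<^sup>2) * H1_norm_sq U a w z"
    by (simp add: H1_norm_sq_def nn_integral_add nn_integral_cmult distrib_left add_ac)
  finally show ?thesis .
qed

lemma H1_linear_combination:
  assumes a: "coefficient_field U a" and U: "open U"
    and uv: "(u, v) \<in> H1 U a" and wz: "(w, z) \<in> H1 U a"
  shows "(\<lambda>x. c * u x + e * w x, \<lambda>x. c *\<^sub>R v x + e *\<^sub>R z x) \<in> H1 U a"
proof -
  have U': "U \<in> sets lebesgue"
    using U by (simp add: lmeasurable_open borel_open)
  obtain f where f: "\<And>n. smooth_on U (f n)" "\<And>n. H1_norm_sq U a (f n) (grad (f n)) < top"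
    "(\<lambda>n. H1_norm_sq U a (\<lambda>x. f n x - u x) (\<lambda>x. grad (f n) x - v x)) \<longlonglongrightarrow> 0"
    using uv unfolding H1_def by blast
  obtain g where g: "\<And>n. smooth_on U (g n)" "\<And>n. H1_norm_sq U a (g n) (grad (g n)) < top"
    "(\<lambda>n. H1_norm_sq U a (\<lambda>x. g n x - w x) (\<lambda>x. grad (g n) x - z x)) \<longlonglongrightarrow> 0"
    using wz unfolding H1_def by blast
  have uv_meas[measurable]: "u \<in> borel_measurable (lebesgue_on U)" "v \<in> borel_measurable (lebesgue_on U)"
    "w \<in> borel_measurable (lebesgue_on U)" "z \<in> borel_measurable (lebesgue_on U)"
    using uv wz by (auto simp: H1_def)
  note [measurable] = smooth_on_measurable[OF f(1) U'] smooth_on_measurable[OF g(1) U']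
  have grad: "grad (\<lambda>x. c * f n x + e * g n x) x = c *\<^sub>R grad (f n) x + e *\<^sub>R grad (g n) x" if "x \<in> U" for n x
  proof -
    have "Ck_on (Suc 0) U (f n)" "Ck_on (Suc 0) U (g n)"
      using f(1) g(1) unfolding smooth_on_def by blast+
    then show ?thesis
      using that by (intro grad_linear_combination) auto
  qed
  \<comment> \<open>The gradient formula holds on \<open>U\<close>, which is all that the norm
    sees.\<close>
  have cong: "H1_norm_sq U a p q = H1_norm_sq U a p' q'"
    if "\<And>x. x \<in> U \<Longrightarrow> p x = p' x" "\<And>x. x \<in> U \<Longrightarrow> q x = q' x" for p q p' q'
    using that by (simp add: H1_norm_sq_def cong: nn_integral_cong_simp)
  have "smooth_on U (\<lambda>x. c * f n x + e * g n x)" for n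
    using U f(1) g(1) by (rule smooth_on_linear_combination)
  moreover have "H1_norm_sq U a (\<lambda>x. c * f n x + e * g n x) (grad (\<lambda>x. c * f n x + e * g n x)) < top" for n
  proof -
    have "H1_norm_sq U a (\<lambda>x. c * f n x + e * g n x) (grad (\<lambda>x. c * f n x + e * g n x))
      = H1_norm_sq U a (\<lambda>x. c * f n x + e * g n x) (\<lambda>x. c *\<^sub>R grad (f n) x + e *\<^sub>R grad (g n) x)"
      by (rule cong) (simp_all add: grad)
    also have "\<dots> \<le> ennreal (2 * c\<^sup>2) * H1_norm_sq U a (f n) (grad (f n)) + ennreal (2 * e\<^sup>2) * H1_norm_sq U a (g n) (grad (g n))"
      by (intro H1_norm_sq_linear_combination_le a U') measurable
    also have "\<dots> < top"
      using f(2)[of n] g(2)[of n] by (simp add: ennreal_mult_less_top)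
    finally show ?thesis .
  qed
  moreover have "(\<lambda>n. H1_norm_sq U a (\<lambda>x. (c * f n x + e * g n x) - (c * u x + e * w x))
      (\<lambda>x. grad (\<lambda>x. c * f n x + e * g n x) x - (c *\<^sub>R v x + e *\<^sub>R z x))) \<longlonglongrightarrow> 0"
  proof (rule tendsto_sandwich[of "\<lambda>_. 0"])
    let ?r = "\<lambda>n. ennreal (2 * c\<^sup>2) * H1_norm_sq U a (\<lambda>x. f n x - u x) (\<lambda>x. grad (f n) x - v x)
      + ennreal (2 * e\<^sup>2) * H1_norm_sq U a (\<lambda>x. g n x - w x) (\<lambda>x. grad (g n) x - z x)"
    have "?r \<longlonglongrightarrow> ennreal (2 * c\<^sup>2) * 0 + ennreal (2 * e\<^sup>2) * 0"
      by (intro tendsto_add ennreal_tendsto_cmult f(3) g(3)) auto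
    then show "?r \<longlonglongrightarrow> 0"
      by simp
    have "H1_norm_sq U a (\<lambda>x. (c * f n x + e * g n x) - (c * u x + e * w x))
        (\<lambda>x. grad (\<lambda>x. c * f n x + e * g n x) x - (c *\<^sub>R v x + e *\<^sub>R z x)) \<le> ?r n" for n
    proof -
      have "H1_norm_sq U a (\<lambda>x. (c * f n x + e * g n x) - (c * u x + e * w x))
          (\<lambda>x. grad (\<lambda>x. c * f n x + e * g n x) x - (c *\<^sub>R v x + e *\<^sub>R z x))
        = H1_norm_sq U a (\<lambda>x. c * (f n x - u x) + e * (g n x - w x))
          (\<lambda>x. c *\<^sub>R (grad (f n) x - v x) + e *\<^sub>R (grad (g n) x - z x))"
        by (rule cong) (simp_all add: grad algebra_simps)
      also have "\<dots> \<le> ?r n"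
        by (intro H1_norm_sq_linear_combination_le a U') measurable
      finally show ?thesis .
    qed
    then show "\<forall>\<^sub>F n in sequentially. H1_norm_sq U a (\<lambda>x. (c * f n x + e * g n x) - (c * u x + e * w x))
        (\<lambda>x. grad (\<lambda>x. c * f n x + e * g n x) x - (c *\<^sub>R v x + e *\<^sub>R z x)) \<le> ?r n"
      by simp
  qed auto
  ultimately show ?thesis
    unfolding H1_def by (auto intro!: exI[of _ "\<lambda>n x. c * f n x + e * g n x"])
qed

text \<open>Membership in \<open>H1\<close> asserts only approximability. Finite energy follows by
  writing \<open>(u, v)\<close> as one smooth approximant of finite norm minus an error of finite
  norm.\<close>

lemma H1_energy_integrable:
  assumes a: "coefficient_field U a" and U: "open U" and uv: "(u, v) \<in> H1 U a"
  shows "integrable (lebesgue_on U) (\<lambda>x. v x \<bullet> (a x *v v x))"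
proof -
  have U': "U \<in> sets lebesgue"
    using U by (simp add: lmeasurable_open borel_open)
  obtain f where f: "\<And>n. smooth_on U (f n)" "\<And>n. H1_norm_sq U a (f n) (grad (f n)) < top"
    "(\<lambda>n. H1_norm_sq U a (\<lambda>x. f n x - u x) (\<lambda>x. grad (f n) x - v x)) \<longlonglongrightarrow> 0"
    using uv unfolding H1_def by blast
  have uv_meas[measurable]: "u \<in> borel_measurable (lebesgue_on U)" "v \<in> borel_measurable (lebesgue_on U)"
    using uv by (auto simp: H1_def)
  note [measurable] = smooth_on_measurable[OF f(1) U']
  have "\<forall>\<^sub>F n in sequentially. H1_norm_sq U a (\<lambda>x. f n x - u x) (\<lambda>x. grad (f n) x - v x) < top"
    using order_tendstoD(2)[OF f(3), of top] by simp
  then obtain n where n: "H1_norm_sq U a (\<lambda>x. f n x - u x) (\<lambda>x. grad (f n) x - v x) < top"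
    using eventually_happens' sequentially_bot by blast
  have "(\<integral>\<^sup>+x. ennreal (v x \<bullet> (a x *v v x)) \<partial>lebesgue_on U) \<le> H1_norm_sq U a u v"
    by (simp add: H1_norm_sq_def)
  also have "H1_norm_sq U a u v = H1_norm_sq U a (\<lambda>x. 1 * f n x + (-1) * (f n x - u x)) (\<lambda>x. 1 *\<^sub>R grad (f n) x + (-1) *\<^sub>R (grad (f n) x - v x))"
    by simp
  also have "\<dots> \<le> ennreal (2 * 1\<^sup>2) * H1_norm_sq U a (f n) (grad (f n))
      + ennreal (2 * (-1)\<^sup>2) * H1_norm_sq U a (\<lambda>x. f n x - u x) (\<lambda>x. grad (f n) x - v x)"
    by (intro H1_norm_sq_linear_combination_le a U') measurable
  also have "\<dots> < top"
    using f(2)[of n] n by (simp add: ennreal_mult_less_top)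
  finally have "(\<integral>\<^sup>+x. ennreal (v x \<bullet> (a x *v v x)) \<partial>lebesgue_on U) < \<infinity>"
    by simp
  moreover have "(\<lambda>x. v x \<bullet> (a x *v v x)) \<in> borel_measurable (lebesgue_on U)"
    using a uv_meas by (intro borel_measurable_form) (auto simp: coefficient_field_def borel_measurable_integrable)
  ultimately show ?thesis
    using psd_nonneg[OF coefficient_field_psd[OF a]] by (intro integrableI_nonneg AE_I2) auto
qed

section \<open>Coarse-grained matrices\<close>

text \<open>The gradient \<open>v\<close> need not be the one that satisfies the equation; working with all pairs avoids
  the uniqueness of the weak gradient, as they already form a linear space.\<close>

definition solution_pairs ::
    "(real^'n) set \<Rightarrow> (real^'n \<Rightarrow> real^'n^'n) \<Rightarrow> ((real^'n \<Rightarrow> real) \<times> (real^'n \<Rightarrow> real^'n)) set"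
  where "solution_pairs U a = {(u, v). u \<in> solutions U a \<and> (u, v) \<in> H1 U a}"

text \<open>Splitting the integral of a combination of solutions requires integrability, since the
  Bochner integral of a non-integrable function is 0 by convention. The majorant adds the energy of
  \<open>v\<close> to a bound on that of \<open>grad \<psi>\<close>, which is controlled by the
  entries of \<open>a\<close> because \<open>grad \<psi>\<close> is bounded on
  \<open>U\<close>.\<close>

lemma integrable_form_test_function:
  assumes a: "coefficient_field U a" and U: "open U" "bounded U"
    and uv: "(u, v) \<in> H1 U a" and \<psi>: "\<psi> \<in> test_functions U"
  shows "integrable (lebesgue_on U) (\<lambda>x. grad \<psi> x \<bullet> (a x *v v x))"
proof -
  let ?M = "lebesgue_on U"
  have U': "U \<in> sets lebesgue"
    using U by (simp add: lmeasurable_open borel_open)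
  have a_int: "integrable ?M a"
    using a by (simp add: coefficient_field_def)
  have cont: "continuous_on UNIV (grad \<psi>)"
    using \<psi> by (auto simp: test_functions_def intro: smooth_on_continuous)
  then have "compact (grad \<psi> ` closure U)"
    using U by (intro compact_continuous_image) (auto intro: continuous_on_subset simp: compact_closure)
  then have "bounded (grad \<psi> ` closure U)"
    by (rule compact_imp_bounded)
  then obtain B where "\<And>y. y \<in> grad \<psi> ` closure U \<Longrightarrow> norm y \<le> B"
    unfolding bounded_iff by blast
  then have B: "norm (grad \<psi> x) \<le> B" if "x \<in> U" for x
    using that closure_subset[of U] by blast
  have grad_meas: "grad \<psi> \<in> borel_measurable ?M"
    using cont U' by (intro continuous_imp_measurable_on_sets_lebesgue continuous_on_subset[OF cont]) auto
  have "integrable ?M (\<lambda>x. (\<Sum>i\<in>UNIV. \<Sum>j\<in>UNIV. \<bar>a x $ i $ j\<bar>) * B\<^sup>2 + v x \<bullet> (a x *v v x))"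
  proof (intro Bochner_Integration.integrable_add integrable_mult_left Bochner_Integration.integrable_sum integrable_abs)
    show "integrable ?M (\<lambda>x. a x $ i $ j)" for i j
      using integrable_matrix_form[OF a_int, of "axis i 1" "axis j 1"]
      by (simp add: inner_axis' matrix_vector_mult_basis column_def)
    show "integrable ?M (\<lambda>x. v x \<bullet> (a x *v v x))"
      using a U(1) uv by (rule H1_energy_integrable)
  qed
  then show ?thesis
  proof (rule Bochner_Integration.integrable_bound)
    show "(\<lambda>x. grad \<psi> x \<bullet> (a x *v v x)) \<in> borel_measurable ?M"
      using a_int grad_meas uv by (intro borel_measurable_form) (auto simp: H1_def)
    show "AE x in ?M. norm (grad \<psi> x \<bullet> (a x *v v x))
        \<le> norm ((\<Sum>i\<in>UNIV. \<Sum>j\<in>UNIV. \<bar>a x $ i $ j\<bar>) * B\<^sup>2 + v x \<bullet> (a x *v v x))"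
    proof (rule AE_I2)
      fix x assume "x \<in> space ?M"
      then have x: "x \<in> U"
        by simp
      let ?g = "grad \<psi> x"
      have psd: "psd (a x)"
        using a x by (rule coefficient_field_psd)
      have "?g \<bullet> (a x *v ?g) = (\<Sum>i\<in>UNIV. \<Sum>j\<in>UNIV. a x $ i $ j * (?g $ i * ?g $ j))"
        by (simp add: inner_vec_def matrix_vector_mult_def sum_distrib_left mult_ac)
      also have "\<dots> \<le> (\<Sum>i\<in>UNIV. \<Sum>j\<in>UNIV. \<bar>a x $ i $ j\<bar> * B\<^sup>2)"
      proof (intro sum_mono)
        fix i j
        have "\<bar>?g $ i\<bar> * \<bar>?g $ j\<bar> \<le> B * B"
          using B[OF x] component_le_norm_cart[of ?g i] component_le_norm_cart[of ?g j]
          by (intro mult_mono) (auto intro: order_trans[OF abs_ge_zero])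
        then have "\<bar>a x $ i $ j\<bar> * \<bar>?g $ i * ?g $ j\<bar> \<le> \<bar>a x $ i $ j\<bar> * B\<^sup>2"
          by (intro mult_left_mono) (auto simp: abs_mult power2_eq_square)
        then show "a x $ i $ j * (?g $ i * ?g $ j) \<le> \<bar>a x $ i $ j\<bar> * B\<^sup>2"
          using abs_ge_self[of "a x $ i $ j * (?g $ i * ?g $ j)"] by (simp add: abs_mult)
      qed
      finally have "?g \<bullet> (a x *v ?g) \<le> (\<Sum>i\<in>UNIV. \<Sum>j\<in>UNIV. \<bar>a x $ i $ j\<bar>) * B\<^sup>2"
        by (simp add: sum_distrib_right)
      then show "norm (?g \<bullet> (a x *v v x))
          \<le> norm ((\<Sum>i\<in>UNIV. \<Sum>j\<in>UNIV. \<bar>a x $ i $ j\<bar>) * B\<^sup>2 + v x \<bullet> (a x *v v x))"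
        using psd_abs_form_le[OF psd, of ?g "v x"] by simp
    qed
  qed
qed

text \<open>The gradients in the given pairs and the gradients \<open>v'\<close>, \<open>z'\<close>
  that satisfy the equation are combined separately: the former give the new pair, the latter show
  that its function is a solution.\<close>

lemma solution_pairs_linear_combination:
  assumes a: "coefficient_field U a" and U: "open U" "bounded U"
    and "(u, v) \<in> solution_pairs U a" "(w, z) \<in> solution_pairs U a"
  shows "(\<lambda>x. c * u x + e * w x, \<lambda>x. c *\<^sub>R v x + e *\<^sub>R z x) \<in> solution_pairs U a"
proof -
  have uv: "(u, v) \<in> H1 U a" and wz: "(w, z) \<in> H1 U a" and u: "u \<in> solutions U a" and w: "w \<in> solutions U a"
    using assms by (auto simp: solution_pairs_def)
  obtain v' where v': "(u, v') \<in> H1 U a"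
    "\<And>\<psi>. \<psi> \<in> test_functions U \<Longrightarrow> (\<integral>x. grad \<psi> x \<bullet> (a x *v v' x) \<partial>lebesgue_on U) = 0"
    using u by (auto simp: solutions_def)
  obtain z' where z': "(w, z') \<in> H1 U a"
    "\<And>\<psi>. \<psi> \<in> test_functions U \<Longrightarrow> (\<integral>x. grad \<psi> x \<bullet> (a x *v z' x) \<partial>lebesgue_on U) = 0"
    using w by (auto simp: solutions_def)
  have "(\<integral>x. grad \<psi> x \<bullet> (a x *v (c *\<^sub>R v' x + e *\<^sub>R z' x)) \<partial>lebesgue_on U) = 0"
    if "\<psi> \<in> test_functions U" for \<psi>
    using integrable_form_test_function[OF a U v'(1) that] integrable_form_test_function[OF a U z'(1) that]
      v'(2)[OF that] z'(2)[OF that]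
    by (simp add: matrix_vector_right_distrib matrix_vector_mult_scaleR inner_add_right)
  then show ?thesis
    using H1_linear_combination[OF a U(1) uv wz] H1_linear_combination[OF a U(1) v'(1) z'(1)]
    by (auto simp: solution_pairs_def solutions_def intro!: exI[of _ "\<lambda>x. c *\<^sub>R v' x + e *\<^sub>R z' x"])
qed

lemma zero_in_solution_pairs: "(\<lambda>x. 0, \<lambda>x. 0) \<in> solution_pairs U a"
proof -
  have grad0: "grad (\<lambda>x::real^'n. 0) = (\<lambda>x. 0)"
    by (simp add: grad_def fun_eq_iff vec_eq_iff)
  have "(\<lambda>x. 0, \<lambda>x. 0) \<in> H1 U a"
    unfolding H1_def
    by (auto intro!: exI[of _ "\<lambda>n x. 0"] simp: smooth_on_def Ck_on_zero grad0 H1_norm_sq_def)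
  then show ?thesis
    by (auto simp: solution_pairs_def solutions_def intro!: exI[of _ "\<lambda>x. 0"])
qed

lemma form_minus: "(- x) \<bullet> (A *v (- x)) = x \<bullet> (A *v x)"
  for x :: "real^'n"
  using form_scaleR[of "-1" x A] by simp

text \<open>\<open>psd_legendre\<close> at \<open>v x\<close> and at \<open>- v x\<close> bounds
  twice the absolute value by the inverse form plus the energy; the former is integrable because the
  inverse field is.\<close>

lemma integrable_gradient_component:
  assumes a: "coefficient_field U a" and U: "open U" and uv: "(u, v) \<in> H1 U a"
  shows "integrable (lebesgue_on U) (\<lambda>x. e \<bullet> v x)"
proof -
  let ?M = "lebesgue_on U"
  have "integrable ?M (\<lambda>x. e \<bullet> (matrix_inv (a x) *v e))"
    using a by (intro integrable_matrix_form) (simp add: coefficient_field_def)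
  then have "integrable ?M (\<lambda>x. e \<bullet> (matrix_inv (a x) *v e) + v x \<bullet> (a x *v v x))"
    using H1_energy_integrable[OF a U uv] by (rule Bochner_Integration.integrable_add)
  then show ?thesis
  proof (rule Bochner_Integration.integrable_bound)
    show "(\<lambda>x. e \<bullet> v x) \<in> borel_measurable ?M"
      using uv by (intro borel_measurable_inner) (auto simp: H1_def)
    have "AE x in ?M. invertible (a x)"
      using a by (simp add: coefficient_field_def)
    then show "AE x in ?M. norm (e \<bullet> v x) \<le> norm (e \<bullet> (matrix_inv (a x) *v e) + v x \<bullet> (a x *v v x))"
    proof (rule AE_mp[OF _ AE_I2], intro impI)
      fix x assume "x \<in> space ?M" and inv: "invertible (a x)"
      then have psd: "psd (a x)"
        using coefficient_field_psd[OF a] by simp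
      show "norm (e \<bullet> v x) \<le> norm (e \<bullet> (matrix_inv (a x) *v e) + v x \<bullet> (a x *v v x))"
        using psd_legendre[OF psd inv, of e "v x"] psd_legendre[OF psd inv, of e "- v x", unfolded form_minus]
          psd_inverse_nonneg[OF psd inv, of e] psd_nonneg[OF psd, of "v x"]
        by (simp add: abs_le_iff form_minus)
    qed
  qed
qed

lemma average_linear_combination:
  assumes "integrable (lebesgue_on U) f" "integrable (lebesgue_on U) g"
  shows "average U (\<lambda>x. c * f x + e * g x) = c * average U f + e * average U g"
  using assms by (simp add: average_def add_divide_distrib)

lemma average_mono_AE:
  assumes "integrable (lebesgue_on U) f" "integrable (lebesgue_on U) g" "AE x in lebesgue_on U. f x \<le> g x"
  shows "average U f \<le> average U g"
  using assms by (auto simp: average_def intro!: divide_right_mono integral_mono_AE)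

text \<open>\<open>quadratic_supremum_is_form\<close>, applied to \<open>solution_pairs\<close>,
  produces a matrix \<open>M\<close>, and \<open>symmetric_matrix_eqI\<close> identifies it with the
  description \<open>astar_inv\<close>. The averages of the inverse form enter as the upper bound on
  the functional.\<close>

lemma onorm_astar_inv_le:
  fixes a :: "real^'n \<Rightarrow> real^'n^'n"
  assumes a: "coefficient_field U a" and U: "open U" "bounded U"
    and K: "\<And>e. average U (\<lambda>x. e \<bullet> (matrix_inv (a x) *v e)) \<le> K * (norm e)\<^sup>2"
  shows "onorm ((*v) (astar_inv a U)) \<le> K"
proof -
  let ?P = "solution_pairs U a"
  define B where "B p = average U (\<lambda>x. snd p x \<bullet> (a x *v snd p x))" for p :: "(real^'n \<Rightarrow> real) \<times> (real^'n \<Rightarrow> real^'n)"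
  define l where "l e p = average U (\<lambda>x. e \<bullet> snd p x)" for e and p :: "(real^'n \<Rightarrow> real) \<times> (real^'n \<Rightarrow> real^'n)"
  have H1: "(fst p, snd p) \<in> H1 U a" if "p \<in> ?P" for p
    using that by (auto simp: solution_pairs_def)
  have int_B: "integrable (lebesgue_on U) (\<lambda>x. snd p x \<bullet> (a x *v snd p x))" if "p \<in> ?P" for p
    using a U(1) H1[OF that] by (rule H1_energy_integrable)
  have int_l: "integrable (lebesgue_on U) (\<lambda>x. e \<bullet> snd p x)" if "p \<in> ?P" for e p
    using a U(1) H1[OF that] by (rule integrable_gradient_component)
  have J: "average U (\<lambda>x. - (snd p x \<bullet> (a x *v snd p x)) + 2 * (e \<bullet> snd p x)) = 2 * l e p - B p"
    if "p \<in> ?P" for e p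
    using average_linear_combination[OF int_B[OF that] int_l[OF that], of "-1" 2 e]
    by (simp add: l_def B_def)
  \<comment> \<open>Sums, differences and multiples of competitors are all instances of
    \<open>comb\<close>; a multiple is the case of second coefficient 0.\<close>
  define comb where "comb c e p q = (\<lambda>x. c * fst p x + e * fst q x, \<lambda>x. c *\<^sub>R snd p x + e *\<^sub>R snd q x)"
    for c e and p q :: "(real^'n \<Rightarrow> real) \<times> (real^'n \<Rightarrow> real^'n)"
  have comb_in: "comb c e p q \<in> ?P" if "p \<in> ?P" "q \<in> ?P" for c e p q
    unfolding comb_def using solution_pairs_linear_combination[OF a U, of "fst p" "snd p" "fst q" "snd q"] that by simp
  have l_comb: "l f (comb c e p q) = c * l f p + e * l f q" if "p \<in> ?P" "q \<in> ?P" for f c e p q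
    unfolding l_def comb_def using average_linear_combination[OF int_l[OF that(1)] int_l[OF that(2)], of c f e f]
    by (simp add: inner_add_right)
  obtain M :: "real^'n^'n" where M: "transpose M = M"
    "\<And>e. ereal (e \<bullet> (M *v e)) = (SUP p\<in>?P. ereal (2 * l e p - B p))"
    "\<And>e. 0 \<le> e \<bullet> (M *v e)" "\<And>e. e \<bullet> (M *v e) \<le> K * (norm e)\<^sup>2"
  proof (rule quadratic_supremum_is_form[of ?P l B K])
    show "?P \<noteq> {}"
      using zero_in_solution_pairs by blast
  next
    fix p assume p: "p \<in> ?P"
    show "linear (\<lambda>e. l e p)"
    proof (rule linearI)
      show "l (e + f) p = l e p + l f p" for e f
        using average_linear_combination[OF int_l[OF p] int_l[OF p], of 1 e 1 f]
        by (simp add: l_def inner_add_left)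
      show "l (c *\<^sub>R e) p = c *\<^sub>R l e p" for c e
        using average_linear_combination[OF int_l[OF p] int_l[OF p], of c e 0 e]
        by (simp add: l_def)
    qed
  next
    fix p q assume p: "p \<in> ?P" and q: "q \<in> ?P"
    have "B (comb 1 1 p q) + B (comb 1 (-1) p q) = 2 * B p + 2 * B q"
      using average_linear_combination[OF int_B[OF comb_in[OF p q, of 1 1]] int_B[OF comb_in[OF p q, of 1 "-1"]], of 1 1]
        average_linear_combination[OF int_B[OF p] int_B[OF q], of 2 2]
      by (simp add: B_def comb_def form_parallelogram)
    then show "\<exists>r\<in>?P. \<exists>s\<in>?P. B r + B s = 2 * B p + 2 * B q \<and>
        (\<forall>e. l e r = l e p + l e q) \<and> (\<forall>e. l e s = l e p - l e q)"
      using comb_in[OF p q] l_comb[OF p q]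
      by (intro bexI[of _ "comb 1 1 p q"] bexI[of _ "comb 1 (-1) p q"]) auto
  next
    fix p c assume p: "p \<in> ?P"
    have "B (comb c 0 p p) = c\<^sup>2 * B p"
      using average_linear_combination[OF int_B[OF p] int_B[OF p], of "c\<^sup>2" 0]
      by (simp add: B_def comb_def matrix_vector_mult_scaleR power2_eq_square mult.assoc)
    then show "\<exists>r\<in>?P. B r = c\<^sup>2 * B p \<and> (\<forall>e. l e r = c * l e p)"
      using comb_in[OF p p] l_comb[OF p p] by (intro bexI[of _ "comb c 0 p p"]) auto
  next
    fix e p assume p: "p \<in> ?P"
    have "average U (\<lambda>x. 2 * (e \<bullet> snd p x) + (-1) * (snd p x \<bullet> (a x *v snd p x)))
      \<le> average U (\<lambda>x. e \<bullet> (matrix_inv (a x) *v e))"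
    proof (rule average_mono_AE)
      show "integrable (lebesgue_on U) (\<lambda>x. 2 * (e \<bullet> snd p x) + (-1) * (snd p x \<bullet> (a x *v snd p x)))"
        using int_l[OF p] int_B[OF p] by (intro Bochner_Integration.integrable_add integrable_mult_right)
      show "integrable (lebesgue_on U) (\<lambda>x. e \<bullet> (matrix_inv (a x) *v e))"
        using a by (intro integrable_matrix_form) (simp add: coefficient_field_def)
      have "AE x in lebesgue_on U. invertible (a x)"
        using a by (simp add: coefficient_field_def)
      then show "AE x in lebesgue_on U. 2 * (e \<bullet> snd p x) + (-1) * (snd p x \<bullet> (a x *v snd p x))
          \<le> e \<bullet> (matrix_inv (a x) *v e)"
      proof (rule AE_mp[OF _ AE_I2], intro impI)
        fix x assume "x \<in> space (lebesgue_on U)" and inv: "invertible (a x)"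
        then have "psd (a x)"
          using coefficient_field_psd[OF a] by simp
        from psd_legendre[OF this inv, of e "snd p x"]
        show "2 * (e \<bullet> snd p x) + (-1) * (snd p x \<bullet> (a x *v snd p x)) \<le> e \<bullet> (matrix_inv (a x) *v e)"
          by simp
      qed
    qed
    then show "2 * l e p - B p \<le> K * (norm e)\<^sup>2"
      unfolding average_linear_combination[OF int_l[OF p] int_B[OF p]] using K[of e]
      by (simp add: l_def B_def)
  qed blast
  \<comment> \<open>Once the supremum in the definition is rewritten as a form, the description only
    asks for equality of two forms.\<close>
  have sup: "(SUP (u, v) \<in> {(u, v). u \<in> solutions U a \<and> (u, v) \<in> H1 U a}.
      ereal (average U (\<lambda>x. - (v x \<bullet> (a x *v v x)) + 2 * (e \<bullet> v x)))) = ereal (e \<bullet> (M *v e))" for e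
  proof -
    have "(SUP (u, v) \<in> ?P. ereal (average U (\<lambda>x. - (v x \<bullet> (a x *v v x)) + 2 * (e \<bullet> v x))))
      = (SUP p\<in>?P. ereal (2 * l e p - B p))"
      by (rule SUP_cong) (simp_all only: split_def J)
    then show ?thesis
      by (simp only: M(2) solution_pairs_def)
  qed
  have "astar_inv a U = M"
    unfolding astar_inv_def sup
  proof (rule the_equality)
    show "transpose M = M \<and> (\<forall>e. ereal (e \<bullet> (M *v e)) = ereal (e \<bullet> (M *v e)))"
      using M(1) by simp
    show "M' = M" if "transpose M' = M' \<and> (\<forall>e. ereal (e \<bullet> (M' *v e)) = ereal (e \<bullet> (M *v e)))" for M'
      using that by (intro symmetric_matrix_eqI[OF _ M(1)]) auto
  qed
  then show ?thesis
    using onorm_symmetric_matrix_le[OF M(1,3,4)] by simp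
qed

section \<open>Bounds for the coarse-grained norm of an arbitrary cone\<close>

lemma cg_coeff_le_average:
  assumes a: "coefficient_field U a"
  shows "cg_coeff K a U e \<le> ereal (average U (\<lambda>x. e \<bullet> (a x *v e)))"
  unfolding cg_coeff_def
proof (rule SUP_least, clarify)
  fix u v
  let ?f = "\<lambda>x. - (v x \<bullet> (a x *v v x)) + 2 * (e \<bullet> (a x *v v x))" and ?g = "\<lambda>x. e \<bullet> (a x *v e)"
  have g: "integrable (lebesgue_on U) ?g"
    using a by (intro integrable_matrix_form) (simp add: coefficient_field_def)
  have le: "?f x \<le> ?g x" and nonneg: "0 \<le> ?g x" if "x \<in> U" for x
  proof -
    have psd: "psd (a x)"
      using a that by (rule coefficient_field_psd)
    show "0 \<le> ?g x"
      using psd by (rule psd_nonneg)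
    show "?f x \<le> ?g x"
      using psd_nonneg[OF psd, of "v x - e"] psd_commute[OF psd, of "v x" e]
      by (simp add: matrix_vector_mult_diff_distrib inner_diff_left inner_diff_right)
  qed
  have "average U ?f \<le> average U ?g"
  proof (cases "integrable (lebesgue_on U) ?f")
    case True
    then show ?thesis
      using g le by (intro average_mono_AE AE_I2) auto
  next
    \<comment> \<open>A non-integrable integrand has average 0 by convention, and the nonnegative
      right-hand side still dominates it.\<close>
    case False
    then have "average U ?f = 0"
      by (simp add: average_def not_integrable_integral_eq)
    also have "0 \<le> average U ?g"
      unfolding average_def using nonneg by (intro divide_nonneg_nonneg integral_nonneg_AE AE_I2) auto
    finally show ?thesis .
  qed
  then show "ereal (average U ?f) \<le> ereal (average U ?g)"
    by simp
qed

lemma cg_norm_le: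
  fixes a :: "real^'n \<Rightarrow> real^'n^'n"
  assumes "coefficient_field U a" "\<And>e. average U (\<lambda>x. e \<bullet> (a x *v e)) \<le> K * (norm e)\<^sup>2"
  shows "cg_norm C a U \<le> ereal K"
  unfolding cg_norm_def
proof (rule SUP_least)
  fix e :: "real^'n" assume "e \<in> {e. norm e = 1}"
  then have "average U (\<lambda>x. e \<bullet> (a x *v e)) \<le> K"
    using assms(2)[of e] by simp
  then show "cg_coeff C a U e \<le> ereal K"
    using cg_coeff_le_average[OF assms(1), of C e] by (simp add: order_trans)
qed

text \<open>For every cone the supremum already runs over pairs in \<open>H1 U a\<close>, and
  \<open>K_max\<close> imposes nothing beyond that.\<close>

lemma cg_norm_le_K_max: "cg_norm C a U \<le> cg_norm K_max a U"
proof -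
  have "cg_coeff C a U e \<le> cg_coeff K_max a U e" for e
    unfolding cg_coeff_def by (rule SUP_subset_mono) (auto simp: K_max_def)
  then show ?thesis
    unfolding cg_norm_def by (intro SUP_mono) blast
qed

section \<open>Triadic scales\<close>

lemma triadic_cube_eq_box:
  "(+) z ` cube (0 - int j) = box (z - vec ((1/3) ^ j / 2)) (z + vec ((1/3) ^ j / 2))"
proof -
  have side: "3 powi (- int j) = (1/3 :: real) ^ j"
    by (simp add: power_int_minus power_one_over inverse_eq_divide)
  show ?thesis
  proof (intro equalityI subsetI)
    fix x assume "x \<in> (+) z ` cube (0 - int j)"
    then obtain y where y: "x = z + y" "\<And>i. \<bar>y $ i\<bar> < (1/3) ^ j / 2"
      by (auto simp: cube_def side)
    have "z $ i - (1/3) ^ j / 2 < x $ i \<and> x $ i < z $ i + (1/3) ^ j / 2" for i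
      using y(2)[of i] unfolding abs_less_iff y(1) by simp
    then show "x \<in> box (z - vec ((1/3) ^ j / 2)) (z + vec ((1/3) ^ j / 2))"
      by (simp add: mem_box_cart)
  next
    fix x assume "x \<in> box (z - vec ((1/3) ^ j / 2)) (z + vec ((1/3) ^ j / 2))"
    then have xz: "z $ i - (1/3) ^ j / 2 < x $ i \<and> x $ i < z $ i + (1/3) ^ j / 2" for i
      by (simp add: mem_box_cart)
    have "\<bar>(x - z) $ i\<bar> < (1/3) ^ j / 2" for i
      using xz[of i] unfolding vector_minus_component abs_less_iff by linarith
    then have "x - z \<in> cube (0 - int j)"
      by (simp add: cube_def side)
    then show "x \<in> (+) z ` cube (0 - int j)"
      by (metis add_diff_cancel_left' image_eqI add.commute diff_add_cancel)
  qed
qed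

lemma cube_0_eq_box: "cube 0 = box (- vec (1/2)) (vec (1/2))"
proof -
  have "\<bar>t\<bar> < 1/2 \<longleftrightarrow> - (1/2) < t \<and> t < 1/2" for t :: real
    by auto
  then show ?thesis
    by (simp only: cube_def mem_box_cart set_eq_iff) simp
qed

text \<open>Each coordinate of \<open>z\<close> is k / 3^j with 2|k| < 3^j. As 3^j is odd, 2|k| is
  at most 3^j - 1, which leaves room for exactly half a side of the small cube.\<close>

lemma triadic_cube_subset:
  assumes "z \<in> triadic_lattice (0 - int j)" "z \<in> cube 0"
  shows "(+) z ` cube (0 - int j) \<subseteq> cube 0"
proof -
  have side: "3 powi (- int j) = (1/3 :: real) ^ j"
    by (simp add: power_int_minus power_one_over inverse_eq_divide)
  have z: "\<bar>z $ i\<bar> \<le> (1 - (1/3) ^ j) / 2" for i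
  proof -
    obtain k :: int where k: "z $ i = (1/3) ^ j * of_int k"
      using assms(1) side by (auto simp: triadic_lattice_def)
    have "\<bar>z $ i\<bar> < 1 / 2"
      using assms(2) by (simp add: cube_def)
    then have "2 * \<bar>real_of_int k\<bar> < 3 ^ j"
      by (simp add: k abs_mult power_one_over field_simps)
    then have "real_of_int (2 * \<bar>k\<bar>) < real_of_int (3 ^ j)"
      by simp
    then have "2 * \<bar>k\<bar> < 3 ^ j"
      by (simp only: of_int_less_iff)
    moreover have "odd (3 ^ j :: int)"
      by simp
    ultimately have "2 * \<bar>k\<bar> \<le> 3 ^ j - 1"
      by presburger
    then have "real_of_int (2 * \<bar>k\<bar>) \<le> real_of_int (3 ^ j - 1)"
      by (simp only: of_int_le_iff)
    then show ?thesis
      by (simp add: k abs_mult power_one_over field_simps)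
  qed
  show ?thesis
  proof
    fix x assume "x \<in> (+) z ` cube (0 - int j)"
    then obtain y where y: "x = z + y" "\<And>i. \<bar>y $ i\<bar> < (1/3) ^ j / 2"
      by (auto simp: cube_def side)
    have "\<bar>x $ i\<bar> < 1 / 2" for i
      using z[of i] y(2)[of i] abs_triangle_ineq[of "z $ i" "y $ i"] by (simp add: y(1))
    then show "x \<in> cube 0"
      by (simp add: cube_def)
  qed
qed

lemma triadic_cube_average_le:
  fixes b :: "real^'n \<Rightarrow> real^'n^'n" and \<alpha> p :: real
  assumes b: "in_neg_sobolev_mat (cube 0) \<alpha> p b" and "1 < p" "0 \<le> \<alpha>" "\<alpha> < 1 - 1 / p"
    and z: "z \<in> triadic_lattice (0 - int j) \<inter> cube 0"
  shows "average ((+) z ` cube (0 - int j)) (\<lambda>x. e \<bullet> (b x *v e))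
    \<le> indicator_const CARD('n) (\<alpha> * (p / (p - 1))) powr (1 / (p / (p - 1)))
      * ((1/3) ^ j) powr (- (\<alpha> + real CARD('n) / p)) * neg_sobolev_norm_mat (cube 0) \<alpha> p b * (norm e)\<^sup>2"
proof -
  have "cube 0 \<in> sets lebesgue"
    by (simp add: cube_0_eq_box)
  moreover have "box (z - vec ((1/3) ^ j / 2)) (z + vec ((1/3) ^ j / 2)) \<subseteq> cube 0"
    using triadic_cube_subset[of z j] z unfolding triadic_cube_eq_box by simp
  moreover have "2 * ((1/3) ^ j / 2) \<le> (1::real)"
    by (simp add: power_le_one)
  ultimately show ?thesis
    using neg_sobolev_mat_average_cube_le[OF b _ assms(2-4), of "(1/3) ^ j / 2" z e]
    unfolding triadic_cube_eq_box by simp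
qed

lemma triadic_cube_coefficient_field:
  assumes "coefficient_field (cube 0) a" "z \<in> triadic_lattice (0 - int j) \<inter> cube 0"
  shows "coefficient_field ((+) z ` cube (0 - int j)) a"
proof (rule coefficient_field_subset[OF assms(1)])
  show "(+) z ` cube (0 - int j) \<subseteq> cube 0"
    using assms(2) by (intro triadic_cube_subset) auto
  show "(+) z ` cube (0 - int j) \<in> sets lebesgue" "cube 0 \<in> sets lebesgue"
    unfolding triadic_cube_eq_box cube_0_eq_box by simp_all
qed

section \<open>Summation over scales\<close>

lemma scale_const_pos: "0 < s \<Longrightarrow> 0 < scale_const s"
  using powr_less_mono[of "- s" 0 3] by (simp add: scale_const_def)

text \<open>Shared by \<open>Lambda_cg\<close> and the inverse of \<open>lambda_cg\<close>.
  \<open>B\<close> is the prefactor and \<eta> the growth exponent of the matrices; the square root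
  halves \<eta>, so s - \<eta>/2 governs the series.\<close>

lemma multiscale_sum_le:
  fixes s \<eta> B :: real
  assumes "0 < s" "0 < s - \<eta> / 2" "0 \<le> B"
    and T: "\<And>j. T j \<le> ennreal (sqrt (B * ((1/3) ^ j) powr (- \<eta>)))"
  shows "(ennreal (scale_const s) * (\<Sum>j. ennreal (3 powr (- s * real j)) * T j))\<^sup>2
    \<le> ennreal ((scale_const s / scale_const (s - \<eta> / 2))\<^sup>2 * B)"
proof -
  let ?\<sigma> = "s - \<eta> / 2"
  have term_eq: "3 powr (- s * real j) * sqrt (B * ((1/3) ^ j) powr (- \<eta>)) = sqrt B * (3 powr (- ?\<sigma>)) ^ j" for j
  proof -
    have "((1/3) ^ j :: real) = 3 powr (- real j)"
      by (simp add: powr_minus powr_realpow power_one_over inverse_eq_divide)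
    then have "((1/3) ^ j :: real) powr (- \<eta>) = 3 powr (\<eta> * real j)"
      by (simp add: powr_powr mult.commute)
    then have "sqrt (((1/3) ^ j :: real) powr (- \<eta>)) = 3 powr (\<eta> * real j / 2)"
      by (simp add: powr_powr flip: powr_half_sqrt)
    moreover have "(3 powr (- ?\<sigma>)) ^ j = (3::real) powr (- s * real j) * 3 powr (\<eta> * real j / 2)"
      by (simp add: powr_power algebra_simps flip: powr_add)
    ultimately show ?thesis
      by (simp add: real_sqrt_mult)
  qed
  have "(\<Sum>j. ennreal (3 powr (- s * real j)) * T j) \<le> (\<Sum>j. ennreal (sqrt B * (3 powr (- ?\<sigma>)) ^ j))"
  proof (rule suminf_le)
    fix j
    have "ennreal (3 powr (- s * real j)) * T j
      \<le> ennreal (3 powr (- s * real j)) * ennreal (sqrt (B * ((1/3) ^ j) powr (- \<eta>)))"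
      by (intro mult_left_mono T) auto
    also have "\<dots> = ennreal (3 powr (- s * real j) * sqrt (B * ((1/3) ^ j) powr (- \<eta>)))"
      by (simp add: ennreal_mult')
    finally show "ennreal (3 powr (- s * real j)) * T j \<le> ennreal (sqrt B * (3 powr (- ?\<sigma>)) ^ j)"
      unfolding term_eq .
  qed auto
  also have "\<dots> = ennreal (sqrt B / scale_const ?\<sigma>)"
    unfolding scale_const_def using assms powr_less_mono[of "- ?\<sigma>" 0 3]
    by (intro suminf_ennreal_geometric) auto
  finally have "ennreal (scale_const s) * (\<Sum>j. ennreal (3 powr (- s * real j)) * T j)
    \<le> ennreal (scale_const s) * ennreal (sqrt B / scale_const ?\<sigma>)"
    by (intro mult_left_mono) auto
  also have "\<dots> = ennreal (scale_const s / scale_const ?\<sigma> * sqrt B)"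
    using scale_const_pos[OF assms(1)] scale_const_pos[OF assms(2)] assms(3)
    by (simp flip: ennreal_mult)
  finally have "(ennreal (scale_const s) * (\<Sum>j. ennreal (3 powr (- s * real j)) * T j))\<^sup>2
    \<le> (ennreal (scale_const s / scale_const ?\<sigma> * sqrt B))\<^sup>2"
    by (intro power_mono) auto
  also have "\<dots> = ennreal ((scale_const s / scale_const ?\<sigma> * sqrt B)\<^sup>2)"
    using scale_const_pos[OF assms(1)] scale_const_pos[OF assms(2)] assms(3)
    by (subst ennreal_power) auto
  also have "(scale_const s / scale_const ?\<sigma> * sqrt B)\<^sup>2 = (scale_const s / scale_const ?\<sigma>)\<^sup>2 * B"
    using assms(3) by (simp add: power_mult_distrib power_divide)
  finally show ?thesis .
qed

lemma neg_sobolev_norm_mat_nonneg: "0 \<le> neg_sobolev_norm_mat U \<alpha> p b"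
  by (simp add: neg_sobolev_norm_mat_def sum_nonneg)

lemma Lambda_cg_le:
  fixes a :: "real^'n \<Rightarrow> real^'n^'n" and \<alpha> p s :: real
  assumes a: "coefficient_field (cube 0) a" and neg: "in_neg_sobolev_mat (cube 0) \<alpha> p a"
    and p: "1 < p" "0 \<le> \<alpha>" "\<alpha> < 1 - 1 / p"
    and s: "0 < s" "0 < s - (\<alpha> + real CARD('n) / p) / 2"
  shows "Lambda_cg s 0 K a \<le> ennreal ((scale_const s / scale_const (s - (\<alpha> + real CARD('n) / p) / 2))\<^sup>2
    * (indicator_const CARD('n) (\<alpha> * (p / (p - 1))) powr (1 / (p / (p - 1))) * neg_sobolev_norm_mat (cube 0) \<alpha> p a))"
  unfolding Lambda_cg_def
proof (rule multiscale_sum_le[OF s])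
  let ?B = "indicator_const CARD('n) (\<alpha> * (p / (p - 1))) powr (1 / (p / (p - 1))) * neg_sobolev_norm_mat (cube 0) \<alpha> p a"
  show "0 \<le> ?B"
    by (simp add: neg_sobolev_norm_mat_nonneg)
  fix j
  let ?k = "?B * ((1/3) ^ j) powr (- (\<alpha> + real CARD('n) / p))"
  show "(SUP z \<in> triadic_lattice (0 - int j) \<inter> cube 0.
      ennpow (e2ennreal (cg_norm K a ((+) z ` cube (0 - int j)))) (1/2)) \<le> ennreal (sqrt ?k)"
  proof (rule SUP_least)
    fix z :: "real^'n" assume z: "z \<in> triadic_lattice (0 - int j) \<inter> cube 0"
    have "cg_norm K a ((+) z ` cube (0 - int j)) \<le> ereal ?k"
      using triadic_cube_average_le[OF neg p z]
      by (intro cg_norm_le triadic_cube_coefficient_field[OF a z]) (simp add: mult_ac)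
    then have "e2ennreal (cg_norm K a ((+) z ` cube (0 - int j))) \<le> ennreal ?k"
      using e2ennreal_mono by fastforce
    then have "ennpow (e2ennreal (cg_norm K a ((+) z ` cube (0 - int j)))) (1/2) \<le> ennpow (ennreal ?k) (1/2)"
      by (intro ennpow_mono) auto
    also have "\<dots> = ennreal (sqrt ?k)"
      by (simp add: ennpow_ennreal powr_half_sqrt neg_sobolev_norm_mat_nonneg)
    finally show "ennpow (e2ennreal (cg_norm K a ((+) z ` cube (0 - int j)))) (1/2) \<le> ennreal (sqrt ?k)" .
  qed
qed

text \<open>Inversion exchanges 0 and \<open>top\<close>, so the inverse of \<open>lambda_cg\<close>
  is the squared sum itself even in the degenerate cases.\<close>

lemma ennreal_inverse_inverse: "inverse (inverse x) = x"
  for x :: ennreal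
proof (cases x rule: ennreal_cases)
  case (real r)
  then show ?thesis
    by (cases "r = 0") (auto simp: inverse_ennreal)
qed simp

lemma inverse_lambda_cg_le:
  fixes a :: "real^'n \<Rightarrow> real^'n^'n" and \<beta> q t :: real
  assumes a: "coefficient_field (cube 0) a" and neg: "in_neg_sobolev_mat (cube 0) \<beta> q (\<lambda>x. matrix_inv (a x))"
    and q: "1 < q" "0 \<le> \<beta>" "\<beta> < 1 - 1 / q"
    and t: "0 < t" "0 < t - (\<beta> + real CARD('n) / q) / 2"
  shows "inverse (lambda_cg t 0 a) \<le> ennreal ((scale_const t / scale_const (t - (\<beta> + real CARD('n) / q) / 2))\<^sup>2
    * (indicator_const CARD('n) (\<beta> * (q / (q - 1))) powr (1 / (q / (q - 1))) * neg_sobolev_norm_mat (cube 0) \<beta> q (\<lambda>x. matrix_inv (a x))))"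
  unfolding lambda_cg_def ennreal_inverse_inverse
proof (rule multiscale_sum_le[OF t])
  let ?B = "indicator_const CARD('n) (\<beta> * (q / (q - 1))) powr (1 / (q / (q - 1))) * neg_sobolev_norm_mat (cube 0) \<beta> q (\<lambda>x. matrix_inv (a x))"
  show "0 \<le> ?B"
    by (simp add: neg_sobolev_norm_mat_nonneg)
  fix j
  let ?k = "?B * ((1/3) ^ j) powr (- (\<beta> + real CARD('n) / q))"
  show "(SUP z \<in> triadic_lattice (0 - int j) \<inter> cube 0.
      ennreal (sqrt (onorm ((*v) (astar_inv a ((+) z ` cube (0 - int j))))))) \<le> ennreal (sqrt ?k)"
  proof (rule SUP_least)
    fix z :: "real^'n" assume z: "z \<in> triadic_lattice (0 - int j) \<inter> cube 0"
    have "onorm ((*v) (astar_inv a ((+) z ` cube (0 - int j)))) \<le> ?k"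
    proof (rule onorm_astar_inv_le[OF triadic_cube_coefficient_field[OF a z]])
      show "open ((+) z ` cube (0 - int j))" "bounded ((+) z ` cube (0 - int j))"
        unfolding triadic_cube_eq_box by (simp_all add: open_box)
    qed (use triadic_cube_average_le[OF neg q z] in \<open>simp add: mult_ac\<close>)
    then show "ennreal (sqrt (onorm ((*v) (astar_inv a ((+) z ` cube (0 - int j)))))) \<le> ennreal (sqrt ?k)"
      by (intro ennreal_leI real_sqrt_le_mono)
  qed
qed

lemma Lambda_cg_le_K_max: "Lambda_cg s m K a \<le> Lambda_cg s m K_max a"
  unfolding Lambda_cg_def
  by (intro power_mono mult_left_mono suminf_le SUP_mono' ennpow_mono e2ennreal_mono cg_norm_le_K_max) auto

text \<open>For \<gamma> = 0 the quotient is \<open>top\<close> and the bound is trivial; otherwise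
  both sides agree.\<close>

lemma indicator_const_powr_le:
  assumes "0 \<le> \<gamma>" "\<gamma> < 1"
  shows "ennreal (indicator_const n \<gamma> powr r)
    \<le> ennpow (ennreal (1 + 32 * real n * 4 ^ n) / ennreal (\<gamma> * (1 - \<gamma>))) r"
proof (cases "\<gamma> = 0")
  case True
  have "(0::real) < 1 + 32 * real n * 4 ^ n"
    by (simp add: add_pos_nonneg)
  then have "ennreal (1 + 32 * real n * 4 ^ n) / 0 = top"
    by (simp add: ennreal_divide_eq_top_iff)
  with True show ?thesis
    by (simp add: ennpow_def)
next
  case False
  then have "ennreal (1 + 32 * real n * 4 ^ n) / ennreal (\<gamma> * (1 - \<gamma>)) = ennreal (indicator_const n \<gamma>)"
    using assms by (subst divide_ennreal) (auto simp: indicator_const_def)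
  then show ?thesis
    using indicator_const_pos[OF assms, of n] by (simp add: ennpow_ennreal)
qed

text \<open>All constants here are real, also for \<alpha> = 0 or \<beta> = 0, so that both
  finiteness and the final estimate can be derived from this form.\<close>

lemma Theta_cg_K_max_le:
  fixes a :: "real^'n \<Rightarrow> real^'n^'n" and \<alpha> \<beta> p q s t :: real
  defines "\<sigma>1 \<equiv> s - (\<alpha> + real CARD('n) / p) / 2" and "\<sigma>2 \<equiv> t - (\<beta> + real CARD('n) / q) / 2"
    and "p' \<equiv> p / (p - 1)" and "q' \<equiv> q / (q - 1)"
  assumes a: "coefficient_field (cube 0) a"
    and A: "in_neg_sobolev_mat (cube 0) \<alpha> p a" and B: "in_neg_sobolev_mat (cube 0) \<beta> q (\<lambda>x. matrix_inv (a x))"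
    and p: "1 < p" "0 \<le> \<alpha>" "\<alpha> < 1 - 1 / p" and q: "1 < q" "0 \<le> \<beta>" "\<beta> < 1 - 1 / q"
    and st: "0 < s" "0 < \<sigma>1" "0 < t" "0 < \<sigma>2"
  shows "Theta_cg s t 0 K_max a \<le> ennreal ((scale_const s)\<^sup>2 * (scale_const t)\<^sup>2 / ((scale_const \<sigma>1)\<^sup>2 * (scale_const \<sigma>2)\<^sup>2))
      * ennreal (indicator_const CARD('n) (\<alpha> * p') powr (1 / p'))
      * ennreal (indicator_const CARD('n) (\<beta> * q') powr (1 / q'))
      * ennreal (neg_sobolev_norm_mat (cube 0) \<alpha> p a)
      * ennreal (neg_sobolev_norm_mat (cube 0) \<beta> q (\<lambda>x. matrix_inv (a x)))"
proof -
  let ?N = "neg_sobolev_norm_mat (cube 0) \<alpha> p a" and ?N' = "neg_sobolev_norm_mat (cube 0) \<beta> q (\<lambda>x. matrix_inv (a x))"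
  let ?I = "indicator_const CARD('n) (\<alpha> * p') powr (1 / p')" and ?I' = "indicator_const CARD('n) (\<beta> * q') powr (1 / q')"
  have "Theta_cg s t 0 K_max a = Lambda_cg s 0 K_max a * inverse (lambda_cg t 0 a)"
    by (simp add: Theta_cg_def divide_ennreal_def)
  also have "\<dots> \<le> ennreal ((scale_const s / scale_const \<sigma>1)\<^sup>2 * (?I * ?N)) * ennreal ((scale_const t / scale_const \<sigma>2)\<^sup>2 * (?I' * ?N'))"
    unfolding \<sigma>1_def \<sigma>2_def p'_def q'_def using st
    by (intro mult_mono Lambda_cg_le inverse_lambda_cg_le a A B p q) (auto simp: \<sigma>1_def \<sigma>2_def)
  also have "\<dots> = ennreal ((scale_const s)\<^sup>2 * (scale_const t)\<^sup>2 / ((scale_const \<sigma>1)\<^sup>2 * (scale_const \<sigma>2)\<^sup>2) * ?I * ?I' * ?N * ?N')"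
    by (simp add: neg_sobolev_norm_mat_nonneg power_divide mult_ac flip: ennreal_mult)
  also have "\<dots> = ennreal ((scale_const s)\<^sup>2 * (scale_const t)\<^sup>2 / ((scale_const \<sigma>1)\<^sup>2 * (scale_const \<sigma>2)\<^sup>2))
      * ennreal ?I * ennreal ?I' * ennreal ?N * ennreal ?N'"
    by (simp add: neg_sobolev_norm_mat_nonneg flip: ennreal_mult)
  finally show ?thesis .
qed

lemma Theta_cg_K_max_finite:
  fixes a :: "real^'n \<Rightarrow> real^'n^'n" and \<alpha> \<beta> p q s t :: real
  assumes "coefficient_field (cube 0) a"
    and "in_neg_sobolev_mat (cube 0) \<alpha> p a" "in_neg_sobolev_mat (cube 0) \<beta> q (\<lambda>x. matrix_inv (a x))"
    and "1 < p" "0 \<le> \<alpha>" "\<alpha> < 1 - 1 / p" "1 < q" "0 \<le> \<beta>" "\<beta> < 1 - 1 / q"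
    and "0 < s" "0 < s - (\<alpha> + real CARD('n) / p) / 2" "0 < t" "0 < t - (\<beta> + real CARD('n) / q) / 2"
  shows "Theta_cg s t 0 K_max a < top"
  by (rule le_less_trans[OF Theta_cg_K_max_le[OF assms]]) (simp add: ennreal_mult_less_top)

lemma Theta_cg_le_K_max: "Theta_cg s t m K a \<le> Theta_cg s t m K_max a"
  unfolding Theta_cg_def by (intro divide_right_mono_ennreal Lambda_cg_le_K_max)

text \<open>The assumption reads \<alpha> < 1/p', the range in which the seminorm bound for the
  indicator of a cube is finite.\<close>

lemma conjugate_exponent_less:
  fixes p \<alpha> :: real
  assumes "1 < p" "\<alpha> < 1 - 1 / p"
  shows "\<alpha> * (p / (p - 1)) < 1"
proof -
  have "\<alpha> * (p / (p - 1)) < (1 - 1 / p) * (p / (p - 1))"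
    using assms by (intro mult_strict_right_mono) auto
  also have "\<dots> = 1"
    using assms by (simp add: field_simps)
  finally show ?thesis .
qed

lemma half_exponent_eq: "x - (u + w / v) / 2 = x - u / 2 - w / (2 * v)"
  for x u v w :: real
  by (simp add: add_divide_distrib mult.commute)

text \<open>The slack \<open>r - A - B\<close> is split evenly between the two exponents.\<close>

lemma exists_scale_exponents:
  fixes A B r :: real
  assumes "0 \<le> A" "0 \<le> B" "A + B < r" "r < 1"
  shows "\<exists>s t. 0 < s \<and> s \<le> 1 \<and> 0 < t \<and> t \<le> 1 \<and> s + t = r \<and> s - A > 0 \<and> t - B > 0"
proof (intro exI conjI)
  let ?s = "A + (r - A - B) / 2" and ?t = "B + (r - A - B) / 2"
  show "?s + ?t = r"
    by (simp add: field_simps)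
qed (use assms in \<open>auto simp: field_simps\<close>)

text \<open>The constraints give \<open>\<sigma>1 + \<sigma>2 = \<sigma> - \<epsilon> / 2\<close>,
  so both can be positive only if \<epsilon> < 2\<sigma>; hence the guard on the existence claim.
  The estimate is asserted for every admissible pair (s, t), not just for one.\<close>

theorem lemma2p6:
  fixes d :: real
  assumes "CARD('n::finite) \<ge> 2" and "d = real CARD('n)"
  shows "\<exists>C::real. C > 0 \<and>
    (\<forall>p q \<alpha> \<beta> \<sigma> \<epsilon> :: real.
      1 < p \<and> 1 < q \<and> 0 \<le> \<alpha> \<and> \<alpha> < 1 \<and> 0 \<le> \<beta> \<and> \<beta> < 1 \<and>
      \<alpha> < 1 - 1 / p \<and> \<beta> < 1 - 1 / q \<and>
      \<sigma> = 1 - d / 2 * (1 / p + 1 / q) - (\<alpha> + \<beta>) / 2 \<and> 0 < \<sigma> \<and>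
      0 < \<epsilon> \<and> \<epsilon> < 1 - \<sigma> \<longrightarrow>
      (\<epsilon> < 2 * \<sigma> \<longrightarrow>
        (\<exists>s t. 0 < s \<and> s \<le> 1 \<and> 0 < t \<and> t \<le> 1 \<and> s + t = 1 - \<epsilon> / 2 \<and>
          s - \<alpha> / 2 - d / (2 * p) > 0 \<and> t - \<beta> / 2 - d / (2 * q) > 0)) \<and>
      (\<forall>s t \<sigma>1 \<sigma>2 p' q'. \<forall>a :: real^'n \<Rightarrow> real^'n^'n.
        0 < s \<and> s \<le> 1 \<and> 0 < t \<and> t \<le> 1 \<and> s + t = 1 - \<epsilon> / 2 \<and>
        \<sigma>1 = s - \<alpha> / 2 - d / (2 * p) \<and> \<sigma>1 > 0 \<and>
        \<sigma>2 = t - \<beta> / 2 - d / (2 * q) \<and> \<sigma>2 > 0 \<and>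
        p' = p / (p - 1) \<and> q' = q / (q - 1) \<and>
        coefficient_field (cube 0) a \<and>
        in_neg_sobolev_mat (cube 0) \<alpha> p a \<and>
        in_neg_sobolev_mat (cube 0) \<beta> q (\<lambda>x. matrix_inv (a x)) \<longrightarrow>
        cg_elliptic_with 0 a s t \<and>
        Theta_cg s t 0 (K_union K_pow K_trunc) a \<le> Theta_cg s t 0 K_max a \<and>
        Theta_cg s t 0 K_max a < top \<and>
        Theta_cg s t 0 K_max a \<le>
          ennreal ((scale_const s)\<^sup>2 * (scale_const t)\<^sup>2 / ((scale_const \<sigma>1)\<^sup>2 * (scale_const \<sigma>2)\<^sup>2)) *
          ennpow (ennreal C / ennreal (\<alpha> * p' * (1 - \<alpha> * p'))) (1 / p') *
          ennpow (ennreal C / ennreal (\<beta> * q' * (1 - \<beta> * q'))) (1 / q') *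
          ennreal (neg_sobolev_norm_mat (cube 0) \<alpha> p a) *
          ennreal (neg_sobolev_norm_mat (cube 0) \<beta> q (\<lambda>x. matrix_inv (a x)))))"
\<comment> \<open>The witness is the numerator of \<open>indicator_const\<close>: 1 for the
  \<open>L\<^sup>r\<close> norm, and 32 = 2 * 16 because the seminorm counts each pair of points in
  both orders.\<close>
proof (rule exI[of _ "1 + 32 * real CARD('n) * 4 ^ CARD('n)"], intro conjI allI impI, goal_cases)
  case 1
  show ?case
    by (simp add: add_pos_nonneg)
next
  case (2 p q \<alpha> \<beta> \<sigma> \<epsilon>)
  have "0 \<le> \<alpha> / 2 + d / (2 * p)" "0 \<le> \<beta> / 2 + d / (2 * q)"
    using 2 assms(2) by (auto intro!: add_nonneg_nonneg divide_nonneg_nonneg)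
  moreover have "(\<alpha> / 2 + d / (2 * p)) + (\<beta> / 2 + d / (2 * q)) < 1 - \<epsilon> / 2"
  proof -
    have "\<sigma> = 1 - d / 2 * (1 / p + 1 / q) - (\<alpha> + \<beta>) / 2"
      using 2 by simp
    moreover have "d / 2 * (1 / p + 1 / q) = d / (2 * p) + d / (2 * q)"
      by (simp add: distrib_left)
    moreover have "\<epsilon> < 2 * \<sigma>"
      using 2 by simp
    ultimately show ?thesis
      unfolding add_divide_distrib by linarith
  qed
  ultimately show ?case
    using exists_scale_exponents[of "\<alpha> / 2 + d / (2 * p)" "\<beta> / 2 + d / (2 * q)" "1 - \<epsilon> / 2"] 2
    by (auto simp: diff_diff_eq)
next
  case (3 p q \<alpha> \<beta> \<sigma> \<epsilon> s t \<sigma>1 \<sigma>2 p' q' a)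
  have "Theta_cg s t 0 K_max a < top"
    using 3 assms(2) by (intro Theta_cg_K_max_finite[of a \<alpha> p \<beta> q s t]) (auto simp: half_exponent_eq)
  \<comment> \<open>The strict bounds s < 1, t < 1 and s + t < 1 follow from s + t = 1 -
    \<epsilon>/2 with s, t and \<epsilon> positive.\<close>
  then show ?case
    using 3 Theta_cg_le_K_max[of s t 0 "K_union K_pow K_trunc" a] by (auto simp: cg_elliptic_with_def)
next
  case (4 p q \<alpha> \<beta> \<sigma> \<epsilon> s t \<sigma>1 \<sigma>2 p' q' a)
  show ?case
    by (rule Theta_cg_le_K_max)
next
  case (5 p q \<alpha> \<beta> \<sigma> \<epsilon> s t \<sigma>1 \<sigma>2 p' q' a)
  then show ?case
    using assms(2) by (intro Theta_cg_K_max_finite[of a \<alpha> p \<beta> q s t]) (auto simp: half_exponent_eq)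
next
  case (6 p q \<alpha> \<beta> \<sigma> \<epsilon> s t \<sigma>1 \<sigma>2 p' q' a)
  have \<sigma>: "s - (\<alpha> + real CARD('n) / p) / 2 = \<sigma>1" "t - (\<beta> + real CARD('n) / q) / 2 = \<sigma>2"
    using 6 assms(2) by (auto simp: half_exponent_eq)
  have p': "p / (p - 1) = p'" "q / (q - 1) = q'"
    using 6 by auto
  have \<gamma>: "0 \<le> \<alpha> * p'" "\<alpha> * p' < 1" "0 \<le> \<beta> * q'" "\<beta> * q' < 1"
    unfolding p'[symmetric] using 6 conjugate_exponent_less[of p \<alpha>] conjugate_exponent_less[of q \<beta>] by auto
  have "Theta_cg s t 0 K_max a \<le> ennreal ((scale_const s)\<^sup>2 * (scale_const t)\<^sup>2 / ((scale_const \<sigma>1)\<^sup>2 * (scale_const \<sigma>2)\<^sup>2))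
      * ennreal (indicator_const CARD('n) (\<alpha> * p') powr (1 / p'))
      * ennreal (indicator_const CARD('n) (\<beta> * q') powr (1 / q'))
      * ennreal (neg_sobolev_norm_mat (cube 0) \<alpha> p a)
      * ennreal (neg_sobolev_norm_mat (cube 0) \<beta> q (\<lambda>x. matrix_inv (a x)))"
    unfolding \<sigma>[symmetric] p'[symmetric]
    by (rule Theta_cg_K_max_le) (use 6 assms(2) in \<open>auto simp: half_exponent_eq\<close>)
  also have "\<dots> \<le> ennreal ((scale_const s)\<^sup>2 * (scale_const t)\<^sup>2 / ((scale_const \<sigma>1)\<^sup>2 * (scale_const \<sigma>2)\<^sup>2))
      * ennpow (ennreal (1 + 32 * real CARD('n) * 4 ^ CARD('n)) / ennreal (\<alpha> * p' * (1 - \<alpha> * p'))) (1 / p')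
      * ennpow (ennreal (1 + 32 * real CARD('n) * 4 ^ CARD('n)) / ennreal (\<beta> * q' * (1 - \<beta> * q'))) (1 / q')
      * ennreal (neg_sobolev_norm_mat (cube 0) \<alpha> p a)
      * ennreal (neg_sobolev_norm_mat (cube 0) \<beta> q (\<lambda>x. matrix_inv (a x)))"
    using \<gamma> by (intro mult_mono order_refl indicator_const_powr_le) auto
  finally show ?case .
qed

end
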